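(* Let $\boldsymbol{\mathcal P}=(\mathcal P_0,\dots,\mathcal P_K)$ be uncertainty sets, $\mathcal P_k$ being specified by the conditional uncertainty sets $\{\mathcal P^{(k)}_\theta:\theta\in\Omega_\Theta\}$, and let $\pi$ be a testing policy of the form $\psi_n=\psi(\boldsymbol z_n,\theta_n)$, $\delta_{k,n}=\delta_k(\boldsymbol z_n)$, where $\boldsymbol z_0=\boldsymbol1$, $\boldsymbol z_{n+1}=\boldsymbol z_n\boldsymbol p_{\theta_n}(x_{n+1})$, $\theta_{n+1}=\xi_{\theta_n}(x_{n+1})$. Let $\gamma_{\pi,\mathcal P_0}:\Omega_\rho\to\mathbb R_{\ge0}\cup\{\infty\}$ and $\alpha^{(k)}_{\pi,\mathcal P_k}:\Omega_\rho\to\mathbb R_{\ge0}$ be the (unique) solutions of $$\gamma_{\pi,\mathcal P_0}(\boldsymbol z,\theta)=(1-\psi(\boldsymbol z,\theta))\Big(1+\sup_{H\in\mathcal P^{(0)}_\theta}\int\gamma_{\pi,\mathcal P_0}\big(\boldsymbol z\boldsymbol p_\theta(x),\xi_\theta(x)\big)H(\mathrm dx)\Big),$$ $$\alpha^{(k)}_{\pi,\mathcal P_k}(\boldsymbol z,\theta)=\psi(\boldsymbol z,\theta)(1-\delta_k(\boldsymbol z))+(1-\psi(\boldsymbol z,\theta))\Big(\sup_{H\in\mathcal P^{(k)}_\theta}\int\alpha^{(k)}_{\pi,\mathcal P_k}\big(\boldsymbol z\boldsymbol p_\theta(x),\xi_\theta(x)\big)H(\mathrm dx)\Big).$$ (i)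 If for every $(\boldsymbol z,\theta)\in\Omega_\rho$ $$\mathcal Q^{(0)}_{\boldsymbol z,\theta}:=\operatorname*{arg\,max}_{H\in\mathcal P^{(0)}_\theta}\int\gamma_{\pi,\mathcal P_0}\big(\boldsymbol z\boldsymbol p_\theta(x),\xi_\theta(x)\big)H(\mathrm dx)\ne\emptyset,$$ then every distribution $$\mathbb Q_0\in\mathcal Q_0:=\Big\{\mathbb P\in\mathbb M:\mathbb P=\prod_{n\ge0}P_{\boldsymbol z_n,\theta_n},\ P_{\boldsymbol z_n,\theta_n}\in\mathcal Q^{(0)}_{\boldsymbol z_n,\theta_n}\Big\}$$ is least favorable with respect to the expected run length of the test, that is, $\gamma(\pi,\mathbb Q_0)=\sup_{\mathbb P\in\mathcal P_0}\gamma(\pi,\mathbb P)$. (ii) For $k=1,\dots,K$: if for every $(\boldsymbol z,\theta)\in\Omega_\rho$ $$\mathcal Q^{(k)}_{\boldsymbol z,\theta}:=\operatorname*{arg\,max}_{H\in\mathcal P^{(k)}_\theta}\int\alpha^{(k)}_{\pi,\mathcal P_k}\big(\boldsymbol z\boldsymbol p_\theta(x),\xi_\theta(x)\big)H(\mathrm dx)\ne\emptyset,$$ then every distribution $$\mathbb Q_k\in\mathcal Q_k:=\Big\{\mathbb P\in\mathbb M:\mathbb P=\prod_{n\ge0}P_{\boldsymbol z_n,\theta_n},\ P_{\boldsymbol z_n,\theta_n}\in\mathcal Q^{(k)}_{\boldsymbol z_n,\theta_n}\Big\}$$ is least favorable with respect to the probability of erroneously deciding against hypothesis $k$, that is, $\alpha_k(\pi,\mathbb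 Q_k)=\sup_{\mathbb P\in\mathcal P_k}\alpha_k(\pi,\mathbb P)$.
   Context: Process. $(X_n)_{n\ge1}$ is a discrete-time process with values in a measurable space $(\Omega_X,\mathcal F_X)$, with natural filtration $(\mathcal F^n_X)_{n\ge1}$, and $\mu$ is a $\sigma$-finite reference measure on $(\Omega_X,\mathcal F_X)$; $\mathcal M_\mu$ is the set of probability distributions on $(\Omega_X,\mathcal F_X)$ with a $\mu$-density. $\mathbb M$ is the set of joint distributions $\mathbb P$ of $(X_n)_{n\ge1}$ admitting a time-homogeneous Markovian representation: there is an adapted statistic, with deterministic known initial value and recursively updated by a fixed measurable map from its previous value and the new observation, such that the conditional distribution of $X_{n+1}$ given $X_1,\dots,X_n$ depends, in a time-independent way, only on the current value of the statistic, and these conditional distributions have densities with respect to $\mu$. For the nominal model the statistic is $\theta_n\in\Omega_\Theta$, $(\Omega_\Theta,\mathcal F_\Theta)$ a measurable space, with initial value $\theta_0$ and measurable update $\theta_{n+1}=\xi(\theta_n,x_{n+1})=:\xi_{\theta_n}(x_{n+1})$; in the definition of $\mathcal Q_0,\dots,\mathcal Q_K$ the statistic is $(\boldsymbol z_n,\theta_n)$ and $P_{\boldsymbol z_n,\theta_n}$ is the conditional distribution of $X_{n+1}$ given the past. Uncertainty sets. For each $\theta\in\Omega_\Theta$ let $\mathcal P^{(k)}_\theta\subset\mathcal M_\mu$. The uncertainty set is $\mathcal P_k=\{\mathbb P\in\mathbb M:\mathbb P=\prod_{n\ge0}P_{\theta_n},\ P_{\theta_n}\in\mathcal P^{(k)}_{\theta_n}\}$,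 i.e. the conditional distribution of $X_{n+1}$ given the past always lies in $\mathcal P^{(k)}_{\theta_n}$; it may depend on the past through a richer statistic than $\theta_n$ as long as $\mathbb P\in\mathbb M$. Policy and performance. $\Omega_\rho=\mathbb R_{\ge0}^{K+1}\times\Omega_\Theta$. $\boldsymbol p_\theta=(p^{(0)}_\theta,\dots,p^{(K)}_\theta)$ is a vector of fixed $\mu$-densities belonging to the policy (not necessarily those of the distributions in $\mathcal P_k$); products of vectors are element-wise. $\psi:\Omega_\rho\to[0,1]$, $\delta_k(\boldsymbol z)\in[0,1]$ with $\sum_k\delta_k=1$. Given that the test has not stopped before, it stops at time $n\ge0$ with probability $\psi(\boldsymbol z_n,\theta_n)$ and then decides for hypothesis $k$ with probability $\delta_k(\boldsymbol z_n)$; $\tau$ is the stopping time; $\gamma(\pi,\mathbb P)=E_{\pi,\mathbb P}[\tau]$ and $\alpha_k(\pi,\mathbb P)=E_{\pi,\mathbb P}[1-\delta_{k,\tau}]$.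
   Formalization: Part (i) is proved under the added assumption that γ_{π,P_0}(1,θ_0) is finite; without it the claim fails, since where γ is infinite a maximizer may postpone forever and have finite expected run length while the supremum over P_0 is infinite. *)

theory Defs
  imports "HOL-Probability.Probability"
begin

section \<open>Processes with a Markovian representation\<close>

text \<open>
  Throughout, \<open>\<mu>\<close> is the reference measure, and the observation space is
  \<open>(space \<mu>, sets \<mu>)\<close>. A path \<open>\<omega> :: nat \<Rightarrow> 'x\<close> lists the observations with a shift
  by one: \<open>\<omega> n\<close> is the value of \<open>X\<^sub>n\<^sub>+\<^sub>1\<close>. The joint distribution of the process
  is a probability measure on \<open>PiM UNIV (\<lambda>_. \<mu>)\<close>; only the sigma-algebra of \<open>\<mu>\<close> enters there.
\<close>

definition distributions_with_density :: "'x measure \<Rightarrow> 'x measure set" where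
  "distributions_with_density \<mu> =
     {density \<mu> f | f. f \<in> borel_measurable \<mu> \<and> prob_space (density \<mu> f)}"

primrec statistic :: "'s \<Rightarrow> ('s \<Rightarrow> 'x \<Rightarrow> 's) \<Rightarrow> (nat \<Rightarrow> 'x) \<Rightarrow> nat \<Rightarrow> 's" where
  "statistic s0 \<zeta> \<omega> 0 = s0"
| "statistic s0 \<zeta> \<omega> (Suc n) = \<zeta> (statistic s0 \<zeta> \<omega> n) (\<omega> n)"

text \<open>The sigma-algebra generated by the first \<open>n\<close> observations.\<close>

definition past :: "'x measure \<Rightarrow> nat \<Rightarrow> (nat \<Rightarrow> 'x) measure" where
  "past \<mu> n = vimage_algebra (space (PiM UNIV (\<lambda>_. \<mu>)))
     (\<lambda>\<omega>. restrict \<omega> {..<n}) (PiM {..<n} (\<lambda>_. \<mu>))"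

text \<open>
  \<open>P\<close> is the product over \<open>n\<close> of the kernels \<open>\<kappa> (s\<^sub>n)\<close>: for all \<open>n\<close>, a regular conditional
  distribution of the next observation given the first \<open>n\<close> ones is \<open>\<kappa>\<close> at the current value of
  the statistic.
\<close>

definition markov_representation ::
  "'x measure \<Rightarrow> 's measure \<Rightarrow> 's \<Rightarrow> ('s \<Rightarrow> 'x \<Rightarrow> 's) \<Rightarrow> ('s \<Rightarrow> 'x measure) \<Rightarrow>
   (nat \<Rightarrow> 'x) measure \<Rightarrow> bool" where
  "markov_representation \<mu> S s0 \<zeta> \<kappa> P \<longleftrightarrow>
     s0 \<in> space S \<and>
     (\<lambda>(s, x). \<zeta> s x) \<in> S \<Otimes>\<^sub>M \<mu> \<rightarrow>\<^sub>M S \<and>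
     \<kappa> \<in> S \<rightarrow>\<^sub>M prob_algebra \<mu> \<and>
     prob_space P \<and> sets P = sets (PiM UNIV (\<lambda>_. \<mu>)) \<and>
     (\<forall>n. \<forall>A\<in>sets \<mu>. \<forall>B\<in>sets (past \<mu> n).
        emeasure P (B \<inter> {\<omega> \<in> space P. \<omega> n \<in> A}) =
        (\<integral>\<^sup>+\<omega>\<in>B. emeasure (\<kappa> (statistic s0 \<zeta> \<omega> n)) A \<partial>P))"

text \<open>
  The constraint on the conditional distributions is imposed almost surely, so that it is a
  property of \<open>P\<close> and does not depend on the version of the conditional distributions.
\<close>

definition markov_constrained ::
  "'x measure \<Rightarrow> 's measure \<Rightarrow> 's \<Rightarrow> ('s \<Rightarrow> 'x \<Rightarrow> 's) \<Rightarrow>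
   (nat \<Rightarrow> (nat \<Rightarrow> 'x) \<Rightarrow> 'x measure set) \<Rightarrow> (nat \<Rightarrow> 'x) measure \<Rightarrow> bool" where
  "markov_constrained \<mu> S s0 \<zeta> C P \<longleftrightarrow>
     (\<exists>\<kappa>. markov_representation \<mu> S s0 \<zeta> \<kappa> P \<and>
        (\<forall>n. AE \<omega> in P. \<kappa> (statistic s0 \<zeta> \<omega> n) \<in> C n \<omega>))"

text \<open>
  The statistic may take values in any measurable space. Letting that space range over all
  measurable spaces whose points are of type \<open>'x list\<close> loses nothing: only the values
  that can be reached from the initial value by finitely many updates matter, and these embed
  into the finite lists of observations (with the transported trace sigma-algebra).
\<close>

definition markov_laws :: "'x measure \<Rightarrow> (nat \<Rightarrow> 'x) measure set" where
  "markov_laws \<mu> =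
     {P. \<exists>(S :: 'x list measure) s0 \<zeta>.
        markov_constrained \<mu> S s0 \<zeta> (\<lambda>n \<omega>. distributions_with_density \<mu>) P}"

text \<open>
  The uncertainty set with conditional uncertainty sets \<open>C \<theta>\<close>. The statistic \<open>s\<^sub>n\<close> of the
  representation may be richer than \<open>\<theta>\<^sub>n\<close>, the statistic of the nominal model.
\<close>

definition uncertainty_set ::
  "'x measure \<Rightarrow> 't \<Rightarrow> ('t \<Rightarrow> 'x \<Rightarrow> 't) \<Rightarrow> ('t \<Rightarrow> 'x measure set) \<Rightarrow>
   (nat \<Rightarrow> 'x) measure set" where
  "uncertainty_set \<mu> \<theta>0 \<xi> C =
     {P \<in> markov_laws \<mu>. \<exists>(S :: 'x list measure) s0 \<zeta>.
        markov_constrained \<mu> S s0 \<zeta> (\<lambda>n \<omega>. C (statistic \<theta>0 \<xi> \<omega> n)) P}"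


section \<open>Testing policies\<close>

text \<open>
  \<open>dens \<pi> \<theta> k\<close> is the \<open>k\<close>-th entry of the vector of densities at \<open>\<theta>\<close>, for \<open>k \<le> last_hyp \<pi>\<close>.
  Vectors indexed by \<open>0, \<dots>, K\<close> are elements of \<open>PiM {..K} _\<close>, i.e. functions that are
  \<open>undefined\<close> beyond \<open>K\<close>.
\<close>

record ('x, 't) policy =
  last_hyp :: nat
  init :: 't
  upd :: "'t \<Rightarrow> 'x \<Rightarrow> 't"
  dens :: "'t \<Rightarrow> nat \<Rightarrow> 'x \<Rightarrow> real"
  stop :: "(nat \<Rightarrow> real) \<times> 't \<Rightarrow> real"
  decide :: "nat \<Rightarrow> (nat \<Rightarrow> real) \<Rightarrow> real"

definition likelihood_space :: "nat \<Rightarrow> (nat \<Rightarrow> real) measure" where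
  "likelihood_space K = PiM {..K} (\<lambda>_. restrict_space borel {0..})"

definition state_space :: "'t measure \<Rightarrow> ('x, 't) policy \<Rightarrow> ((nat \<Rightarrow> real) \<times> 't) measure" where
  "state_space \<Theta> \<pi> = likelihood_space (last_hyp \<pi>) \<Otimes>\<^sub>M \<Theta>"

definition testing_policy :: "'x measure \<Rightarrow> 't measure \<Rightarrow> ('x, 't) policy \<Rightarrow> bool" where
  "testing_policy \<mu> \<Theta> \<pi> \<longleftrightarrow>
     init \<pi> \<in> space \<Theta> \<and>
     (\<lambda>(\<theta>, x). upd \<pi> \<theta> x) \<in> \<Theta> \<Otimes>\<^sub>M \<mu> \<rightarrow>\<^sub>M \<Theta> \<and>
     (\<forall>k\<le>last_hyp \<pi>. (\<lambda>(\<theta>, x). dens \<pi> \<theta> k x) \<in> borel_measurable (\<Theta> \<Otimes>\<^sub>M \<mu>)) \<and>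
     (\<forall>k\<le>last_hyp \<pi>. \<forall>\<theta>\<in>space \<Theta>.
        (\<forall>x\<in>space \<mu>. 0 \<le> dens \<pi> \<theta> k x) \<and> (\<integral>\<^sup>+x. dens \<pi> \<theta> k x \<partial>\<mu>) = 1) \<and>
     stop \<pi> \<in> borel_measurable (state_space \<Theta> \<pi>) \<and>
     (\<forall>s\<in>space (state_space \<Theta> \<pi>). stop \<pi> s \<in> {0..1}) \<and>
     (\<forall>k\<le>last_hyp \<pi>. decide \<pi> k \<in> borel_measurable (likelihood_space (last_hyp \<pi>))) \<and>
     (\<forall>z\<in>space (likelihood_space (last_hyp \<pi>)).
        (\<forall>k\<le>last_hyp \<pi>. decide \<pi> k z \<in> {0..1}) \<and> (\<Sum>k\<le>last_hyp \<pi>. decide \<pi> k z) = 1)"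

definition init_state :: "('x, 't) policy \<Rightarrow> (nat \<Rightarrow> real) \<times> 't" where
  "init_state \<pi> = (\<lambda>k\<in>{..last_hyp \<pi>}. 1, init \<pi>)"

definition next_state ::
  "('x, 't) policy \<Rightarrow> (nat \<Rightarrow> real) \<times> 't \<Rightarrow> 'x \<Rightarrow> (nat \<Rightarrow> real) \<times> 't" where
  "next_state \<pi> = (\<lambda>(z, \<theta>) x. (\<lambda>k\<in>{..last_hyp \<pi>}. z k * dens \<pi> \<theta> k x, upd \<pi> \<theta> x))"

definition state :: "('x, 't) policy \<Rightarrow> (nat \<Rightarrow> 'x) \<Rightarrow> nat \<Rightarrow> (nat \<Rightarrow> real) \<times> 't" where
  "state \<pi> = statistic (init_state \<pi>) (next_state \<pi>)"

text \<open>
  The law of the stopping time given the path: conditionally on not having stopped before, the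
  test stops at time \<open>n\<close> with probability \<open>\<psi>(z\<^sub>n, \<theta>\<^sub>n)\<close>. The remaining mass is the probability
  of never stopping.
\<close>

definition stop_prob :: "('x, 't) policy \<Rightarrow> (nat \<Rightarrow> 'x) \<Rightarrow> nat \<Rightarrow> real" where
  "stop_prob \<pi> \<omega> n = stop \<pi> (state \<pi> \<omega> n) * (\<Prod>i<n. 1 - stop \<pi> (state \<pi> \<omega> i))"

definition stopping_law :: "('x, 't) policy \<Rightarrow> (nat \<Rightarrow> 'x) \<Rightarrow> enat measure" where
  "stopping_law \<pi> \<omega> = density (count_space UNIV)
     (\<lambda>t. case t of enat n \<Rightarrow> ennreal (stop_prob \<pi> \<omega> n)
        | \<infinity> \<Rightarrow> 1 - (\<Sum>n. ennreal (stop_prob \<pi> \<omega> n)))"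

definition expected_run_length :: "('x, 't) policy \<Rightarrow> (nat \<Rightarrow> 'x) measure \<Rightarrow> ennreal" where
  "expected_run_length \<pi> P = (\<integral>\<^sup>+\<omega>. \<integral>\<^sup>+t. ennreal_of_enat t \<partial>stopping_law \<pi> \<omega> \<partial>P)"

text \<open>No error is counted on paths on which the test never stops, as no decision is made there.\<close>

definition error_prob :: "('x, 't) policy \<Rightarrow> nat \<Rightarrow> (nat \<Rightarrow> 'x) measure \<Rightarrow> ennreal" where
  "error_prob \<pi> k P =
     (\<integral>\<^sup>+\<omega>. \<integral>\<^sup>+t. (case t of enat n \<Rightarrow> ennreal (1 - decide \<pi> k (fst (state \<pi> \<omega> n))) | \<infinity> \<Rightarrow> 0)
        \<partial>stopping_law \<pi> \<omega> \<partial>P)"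


section \<open>The integral equations\<close>

definition run_length_op ::
  "('x, 't) policy \<Rightarrow> ('t \<Rightarrow> 'x measure set) \<Rightarrow> ((nat \<Rightarrow> real) \<times> 't \<Rightarrow> ennreal) \<Rightarrow>
   (nat \<Rightarrow> real) \<times> 't \<Rightarrow> ennreal" where
  "run_length_op \<pi> C f = (\<lambda>(z, \<theta>).
     ennreal (1 - stop \<pi> (z, \<theta>)) *
     (1 + (SUP H\<in>C \<theta>. \<integral>\<^sup>+x. f (next_state \<pi> (z, \<theta>) x) \<partial>H)))"

definition error_op ::
  "('x, 't) policy \<Rightarrow> nat \<Rightarrow> ('t \<Rightarrow> 'x measure set) \<Rightarrow> ((nat \<Rightarrow> real) \<times> 't \<Rightarrow> ennreal) \<Rightarrow>
   (nat \<Rightarrow> real) \<times> 't \<Rightarrow> ennreal" where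
  "error_op \<pi> k C f = (\<lambda>(z, \<theta>).
     ennreal (stop \<pi> (z, \<theta>) * (1 - decide \<pi> k z)) +
     ennreal (1 - stop \<pi> (z, \<theta>)) *
     (SUP H\<in>C \<theta>. \<integral>\<^sup>+x. f (next_state \<pi> (z, \<theta>) x) \<partial>H))"

text \<open>
  \<open>f\<close> is a measurable fixed point of \<open>T\<close>, and the only fixed point among the functions bounded by
  a multiple of \<open>f\<close>. Uniqueness among all nonnegative functions implies this, but would be
  too much to ask: if the test stops in each step with a constant probability \<open>0 < c < 1\<close>, then
  \<open>\<infinity>\<close> solves the equation for the run length besides \<open>(1 - c) / c\<close>, and the equation for
  the error probability may have further, unbounded solutions. Competitors \<open>g\<close> need not be
  measurable, since a supremum over an uncountable set of distributions need not preserve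
  measurability.

  The solution of the run length equation may be infinite. Where it is, attaining the supremum in
  the equation says nothing about the quality of a maximizer: continuing to a next state of infinite
  value is then maximal, even if always continuing yields a finite run length. Hence results on
  maximizers need the solution to be finite at the initial state.
\<close>

definition unique_solution ::
  "'s measure \<Rightarrow> (('s \<Rightarrow> ennreal) \<Rightarrow> 's \<Rightarrow> ennreal) \<Rightarrow> ('s \<Rightarrow> ennreal) \<Rightarrow> bool" where
  "unique_solution S T f \<longleftrightarrow>
     f \<in> borel_measurable S \<and>
     (\<forall>s\<in>space S. f s = T f s) \<and>
     (\<forall>g. (\<forall>s\<in>space S. g s = T g s) \<and> (\<exists>c<\<infinity>. \<forall>s\<in>space S. g s \<le> c * f s) \<longrightarrow>
        (\<forall>s\<in>space S. g s = f s))"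


section \<open>Maximizing conditional distributions\<close>

definition maximizers ::
  "('x, 't) policy \<Rightarrow> ('t \<Rightarrow> 'x measure set) \<Rightarrow> ((nat \<Rightarrow> real) \<times> 't \<Rightarrow> ennreal) \<Rightarrow>
   (nat \<Rightarrow> real) \<times> 't \<Rightarrow> 'x measure set" where
  "maximizers \<pi> C f = (\<lambda>(z, \<theta>).
     {H. is_arg_max (\<lambda>H. \<integral>\<^sup>+x. f (next_state \<pi> (z, \<theta>) x) \<partial>H) (\<lambda>H. H \<in> C \<theta>) H})"

text \<open>
  Distributions whose representing statistic is \<open>(z\<^sub>n, \<theta>\<^sub>n)\<close> itself and whose conditional
  distributions are taken from \<open>Q (z\<^sub>n, \<theta>\<^sub>n)\<close>.
\<close>

definition policy_markov_laws ::
  "'x measure \<Rightarrow> 't measure \<Rightarrow> ('x, 't) policy \<Rightarrow>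
   ((nat \<Rightarrow> real) \<times> 't \<Rightarrow> 'x measure set) \<Rightarrow> (nat \<Rightarrow> 'x) measure set" where
  "policy_markov_laws \<mu> \<Theta> \<pi> Q =
     {P \<in> markov_laws \<mu>.
        markov_constrained \<mu> (state_space \<Theta> \<pi>) (init_state \<pi>) (next_state \<pi>)
          (\<lambda>n \<omega>. Q (state \<pi> \<omega> n)) P}"

definition least_favorable ::
  "((nat \<Rightarrow> 'x) measure \<Rightarrow> ennreal) \<Rightarrow> (nat \<Rightarrow> 'x) measure set \<Rightarrow> (nat \<Rightarrow> 'x) measure \<Rightarrow> bool" where
  "least_favorable J \<P> Q \<longleftrightarrow> J Q = (SUP P\<in>\<P>. J P)"

end

theory Submission
  imports Defs
begin

text \<open>
  The expected run length and the error probabilities are both total costs. Along the states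
  \<open>s\<^sub>n = (z\<^sub>n, \<theta>\<^sub>n)\<close> of the test they have the form \<open>E (\<Sum>n. (\<Prod>i<n. b s\<^sub>i) * a s\<^sub>n)\<close>, where
  \<open>b = 1 - \<psi>\<close> is the probability to continue, and \<open>a\<close> is \<open>1 - \<psi>\<close> for the run length and
  \<open>\<psi> * (1 - \<delta>\<^sub>k)\<close> for the error (\<open>expected_run_length_eq_total_cost\<close>, \<open>error_prob_eq_total_cost\<close>).
  The integral equations are the Bellman equations \<open>v = a + b * sup\<^sub>H \<integral> v dH\<close> of these costs.

  The solution \<open>v\<close> at the initial state is an upper bound for the cost under every law in the
  uncertainty set (\<open>total_cost_le_solution\<close>): the conditional distribution given the past is
  one of the candidates in the supremum, so that the cost paid so far plus the expected value of
  \<open>v\<close> at the present state cannot increase. This remains true if the law remembers more of the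
  past than the test does.

  Under a law that selects maximizers this sum is constant, and it remains to show that the part
  \<open>r\<^sub>n = E ((\<Prod>i<n. b s\<^sub>i) * v s\<^sub>n)\<close> that is not yet paid at time \<open>n\<close> tends to 0. This is where
  uniqueness of the solution enters (\<open>continuation_vanishes\<close>). If the limit \<open>r\<close> of \<open>r\<^sub>n\<close>, as a
  function of the initial state, were positive, then \<open>v + r\<close> would be a subsolution between \<open>v\<close>
  and \<open>2 * v\<close>, and by the Knaster-Tarski theorem there would be a second solution below \<open>2 * v\<close>
  (\<open>unique_solution_greatest\<close>).

  The function \<open>r\<close> requires the law of the process from every state and not only from the initial
  one. Moreover, maximizers are selected only almost surely along the path, on a set of states
  that need not be measurable. Both are dealt with by a family of path laws that is
  measurable in the initial state and satisfies the Markov property at time 1 (\<open>path_law_step\<close>,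
  \<open>AE_path_law_step\<close>).

  Finally, a law that selects maximizers belongs to the uncertainty set, because its statistic
  can be replaced by the full history of observations (\<open>markov_constrained_history\<close>).
\<close>

section \<open>Disintegration along the path\<close>

abbreviation paths :: "'x measure \<Rightarrow> (nat \<Rightarrow> 'x) measure" where
  "paths \<mu> \<equiv> PiM UNIV (\<lambda>_. \<mu>)"

lemma space_past [simp]: "space (past \<mu> n) = space (paths \<mu>)"
  by (simp add: past_def)

lemma measurable_past_component:
  assumes "i < n"
  shows "(\<lambda>\<omega>. \<omega> i) \<in> past \<mu> n \<rightarrow>\<^sub>M \<mu>"
proof -
  have "(\<lambda>\<omega>. restrict \<omega> {..<n}) \<in> past \<mu> n \<rightarrow>\<^sub>M PiM {..<n} (\<lambda>_. \<mu>)"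
    unfolding past_def
  proof (rule measurable_vimage_algebra1, rule funcsetI)
    fix \<omega> assume "\<omega> \<in> space (paths \<mu>)"
    then show "restrict \<omega> {..<n} \<in> space (PiM {..<n} (\<lambda>_. \<mu>))"
      unfolding space_PiM by (intro restrict_PiE_iff[THEN iffD2]) auto
  qed
  from measurable_compose[OF this measurable_component_singleton[of i]] assms
  show ?thesis
    by simp
qed

lemma sets_past_subset: "sets (past \<mu> n) \<subseteq> sets (paths \<mu>)"
  unfolding past_def by (rule sets_image_in_sets) (auto intro!: measurable_restrict)

lemma measurable_from_past: "f \<in> past \<mu> n \<rightarrow>\<^sub>M N \<Longrightarrow> f \<in> paths \<mu> \<rightarrow>\<^sub>M N"
  by (rule measurable_from_subalg[of "paths \<mu>" "past \<mu> n"])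
    (auto simp: subalgebra_def sets_past_subset)

lemma measurable_statistic:
  assumes [measurable]: "(\<lambda>(s, x). \<zeta> s x) \<in> S \<Otimes>\<^sub>M \<mu> \<rightarrow>\<^sub>M S" and s0: "s0 \<in> space S"
    and comp: "\<And>i. i < n \<Longrightarrow> (\<lambda>\<omega>. \<omega> i) \<in> N \<rightarrow>\<^sub>M \<mu>"
  shows "(\<lambda>\<omega>. statistic s0 \<zeta> \<omega> n) \<in> N \<rightarrow>\<^sub>M S"
  using comp
proof (induction n)
  case 0
  then show ?case using s0 by simp
next
  case (Suc n)
  have [measurable]: "(\<lambda>\<omega>. statistic s0 \<zeta> \<omega> n) \<in> N \<rightarrow>\<^sub>M S" "(\<lambda>\<omega>. \<omega> n) \<in> N \<rightarrow>\<^sub>M \<mu>"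
    using Suc by auto
  show ?case by simp
qed

lemma measurable_statistic_past:
  assumes "(\<lambda>(s, x). \<zeta> s x) \<in> S \<Otimes>\<^sub>M \<mu> \<rightarrow>\<^sub>M S" "s0 \<in> space S" "m \<le> n"
  shows "(\<lambda>\<omega>. statistic s0 \<zeta> \<omega> m) \<in> past \<mu> n \<rightarrow>\<^sub>M S"
  by (rule measurable_statistic[OF assms(1,2)], rule measurable_past_component) (use assms(3) in auto)

lemma statistic_in_space:
  assumes "(\<lambda>(s, x). \<zeta> s x) \<in> S \<Otimes>\<^sub>M \<mu> \<rightarrow>\<^sub>M S" "s0 \<in> space S" "\<omega> \<in> space (paths \<mu>)"
  shows "statistic s0 \<zeta> \<omega> n \<in> space S"
  using measurable_space[OF measurable_statistic_past[OF assms(1,2) order.refl]] assms(3) by simp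

lemma statistic_case_nat: "statistic s \<zeta> (case_nat x \<omega>) (Suc n) = statistic (\<zeta> s x) \<zeta> \<omega> n"
  by (induction n) auto

text \<open>
  The defining property of a representation is this identity for indicators of rectangles
  \<open>B \<times> A\<close>. Rectangles generate the product sigma-algebra and are closed under intersection, so
  the law of \<open>(\<omega>, \<omega> n)\<close> on \<open>past \<mu> n \<Otimes>\<^sub>M \<mu>\<close> is the composition of \<open>P\<close> with the kernel \<open>\<kappa>\<close>. The
  integrand may depend on the whole past, and not only on the statistic that represents \<open>P\<close>: the
  state of the test and the statistic of a law in the uncertainty set are unrelated.
\<close>

lemma disintegration:
  assumes rep: "markov_representation \<mu> S s0 \<zeta> \<kappa> P"
    and F: "(\<lambda>(\<omega>, x). F \<omega> x) \<in> borel_measurable (past \<mu> n \<Otimes>\<^sub>M \<mu>)"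
  shows "(\<integral>\<^sup>+\<omega>. F \<omega> (\<omega> n) \<partial>P) = (\<integral>\<^sup>+\<omega>. \<integral>\<^sup>+x. F \<omega> x \<partial>\<kappa> (statistic s0 \<zeta> \<omega> n) \<partial>P)"
proof -
  from rep have s0: "s0 \<in> space S" and \<zeta>: "(\<lambda>(s, x). \<zeta> s x) \<in> S \<Otimes>\<^sub>M \<mu> \<rightarrow>\<^sub>M S"
    and \<kappa>: "\<kappa> \<in> S \<rightarrow>\<^sub>M prob_algebra \<mu>" and P: "prob_space P"
    and sets_P: "sets P = sets (paths \<mu>)"
    and cond: "\<And>A B. A \<in> sets \<mu> \<Longrightarrow> B \<in> sets (past \<mu> n) \<Longrightarrow>
        emeasure P (B \<inter> {\<omega> \<in> space P. \<omega> n \<in> A}) =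
        (\<integral>\<^sup>+\<omega>\<in>B. emeasure (\<kappa> (statistic s0 \<zeta> \<omega> n)) A \<partial>P)"
    by (auto simp: markov_representation_def)
  interpret P: prob_space P by (rule P)
  have space_P: "space P = space (paths \<mu>)"
    by (rule sets_eq_imp_space_eq[OF sets_P])
  have stat: "(\<lambda>\<omega>. statistic s0 \<zeta> \<omega> n) \<in> past \<mu> n \<rightarrow>\<^sub>M S"
    by (rule measurable_statistic_past[OF \<zeta> s0 order.refl])
  define k where "k \<omega> = \<kappa> (statistic s0 \<zeta> \<omega> n)" for \<omega>
  have k: "k \<in> past \<mu> n \<rightarrow>\<^sub>M prob_algebra \<mu>"
    unfolding k_def by (rule measurable_compose[OF stat \<kappa>])
  have id: "(\<lambda>\<omega>. \<omega>) \<in> P \<rightarrow>\<^sub>M past \<mu> n"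
    using sets_past_subset by (auto simp: measurable_def sets_P space_P dest: sets.sets_into_space)
  define N where "N = distr P (past \<mu> n) (\<lambda>\<omega>. \<omega>)"
  have N: "prob_space N" "sets N = sets (past \<mu> n)" "space N = space (paths \<mu>)"
    by (auto simp: N_def P.prob_space_distr[OF id])
  define K where "K \<omega> = distr (k \<omega>) (past \<mu> n \<Otimes>\<^sub>M \<mu>) (Pair \<omega>)" for \<omega>
  have K: "K \<in> past \<mu> n \<rightarrow>\<^sub>M prob_algebra (past \<mu> n \<Otimes>\<^sub>M \<mu>)"
    unfolding K_def using k by measurable
  have N_alg: "N \<in> space (prob_algebra (past \<mu> n))"
    using N by (simp add: space_prob_algebra)
  have pair: "(\<lambda>\<omega>. (\<omega>, \<omega> n)) \<in> P \<rightarrow>\<^sub>M past \<mu> n \<Otimes>\<^sub>M \<mu>"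
    using id by (rule measurable_Pair) (simp add: measurable_cong_sets[OF sets_P refl])
  have space_k: "space (k \<omega>) = space \<mu>" "sets (k \<omega>) = sets \<mu>" if "\<omega> \<in> space (paths \<mu>)" for \<omega>
    using measurable_space[OF k] that
    by (auto simp: space_prob_algebra dest: sets_eq_imp_space_eq)
  have Pair_k: "Pair \<omega> \<in> k \<omega> \<rightarrow>\<^sub>M past \<mu> n \<Otimes>\<^sub>M \<mu>" if "\<omega> \<in> space (paths \<mu>)" for \<omega>
    using that by (simp add: measurable_cong_sets[OF space_k(2)[OF that] refl])
  have eq: "distr P (past \<mu> n \<Otimes>\<^sub>M \<mu>) (\<lambda>\<omega>. (\<omega>, \<omega> n)) = N \<bind> K" (is "?L = ?R")
  proof (rule measure_eqI_generator_eq[where A="\<lambda>_. space (past \<mu> n) \<times> space \<mu>"])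
    show "Int_stable {a \<times> b | a b. a \<in> sets (past \<mu> n) \<and> b \<in> sets \<mu>}"
      by (rule Int_stable_pair_measure_generator)
    show "sets ?L = sigma_sets (space (past \<mu> n) \<times> space \<mu>)
      {a \<times> b | a b. a \<in> sets (past \<mu> n) \<and> b \<in> sets \<mu>}"
      by (simp add: sets_pair_measure)
    show "sets ?R = sigma_sets (space (past \<mu> n) \<times> space \<mu>)
      {a \<times> b | a b. a \<in> sets (past \<mu> n) \<and> b \<in> sets \<mu>}"
      by (simp add: sets_bind'[OF N_alg K] sets_pair_measure)
    show "emeasure ?L X = emeasure ?R X"
      if X_in: "X \<in> {a \<times> b | a b. a \<in> sets (past \<mu> n) \<and> b \<in> sets \<mu>}" for X
    proof -
      obtain B A where X: "X = B \<times> A" and B: "B \<in> sets (past \<mu> n)" and A: "A \<in> sets \<mu>"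
        using X_in by blast
      have KX: "emeasure (K \<omega>) X = emeasure (k \<omega>) A * indicator B \<omega>" if "\<omega> \<in> space (paths \<mu>)" for \<omega>
      proof -
        have "emeasure (K \<omega>) X = emeasure (k \<omega>) (Pair \<omega> -` X \<inter> space (k \<omega>))"
          unfolding K_def X using A B that by (intro emeasure_distr Pair_k) auto
        also have "Pair \<omega> -` X \<inter> space (k \<omega>) = (if \<omega> \<in> B then A else {})"
          using sets.sets_into_space[OF A] by (auto simp: X space_k(1)[OF that])
        finally show ?thesis by simp
      qed
      have "emeasure ?R X = (\<integral>\<^sup>+\<omega>. emeasure (K \<omega>) X \<partial>N)"
        using A B by (intro emeasure_bind_prob_algebra[OF N_alg K]) (auto simp: X)
      also have "\<dots> = (\<integral>\<^sup>+\<omega>. emeasure (K \<omega>) X \<partial>P)"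
        unfolding N_def
        using A B measurable_emeasure_kernel[OF measurable_prob_algebraD[OF K], of X]
        by (intro nn_integral_distr id) (auto simp: X)
      also have "\<dots> = (\<integral>\<^sup>+\<omega>\<in>B. emeasure (k \<omega>) A \<partial>P)"
        by (intro nn_integral_cong) (simp add: KX space_P)
      also have "\<dots> = emeasure P (B \<inter> {\<omega> \<in> space P. \<omega> n \<in> A})"
        using cond[OF A B] by (simp add: k_def)
      also have "B \<inter> {\<omega> \<in> space P. \<omega> n \<in> A} = (\<lambda>\<omega>. (\<omega>, \<omega> n)) -` X \<inter> space P"
        by (auto simp: X)
      also have "emeasure P \<dots> = emeasure ?L X"
        using A B by (intro emeasure_distr[symmetric] pair) (auto simp: X)
      finally show ?thesis ..
    qed
    show "emeasure ?L (space (past \<mu> n) \<times> space \<mu>) \<noteq> \<infinity>"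
      by (rule finite_measure.emeasure_finite[OF
          prob_space.finite_measure[OF P.prob_space_distr[OF pair]], unfolded infinity_ennreal_def[symmetric]])
    have "space (past \<mu> n) \<in> sets (past \<mu> n)" by (rule sets.top)
    then show "range (\<lambda>_::nat. space (past \<mu> n) \<times> space \<mu>) \<subseteq>
        {a \<times> b | a b. a \<in> sets (past \<mu> n) \<and> b \<in> sets \<mu>}" by blast
    show "{a \<times> b | a b. a \<in> sets (past \<mu> n) \<and> b \<in> sets \<mu>} \<subseteq>
        Pow (space (past \<mu> n) \<times> space \<mu>)"
      using sets.space_closed[of "past \<mu> n"] sets.space_closed[of \<mu>] by fast
  qed simp
  have "(\<integral>\<^sup>+\<omega>. F \<omega> (\<omega> n) \<partial>P) = (\<integral>\<^sup>+y. (case y of (\<omega>, x) \<Rightarrow> F \<omega> x) \<partial>?L)"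
    by (subst nn_integral_distr[OF pair]) (use F in auto)
  also have "\<dots> = (\<integral>\<^sup>+\<omega>. \<integral>\<^sup>+y. (case y of (\<omega>, x) \<Rightarrow> F \<omega> x) \<partial>K \<omega> \<partial>N)"
    unfolding eq
    by (rule nn_integral_bind[OF F])
      (use measurable_prob_algebraD[OF K] N(2) in \<open>simp cong: measurable_cong_sets\<close>)
  also have "\<dots> = (\<integral>\<^sup>+\<omega>. \<integral>\<^sup>+y. (case y of (\<omega>, x) \<Rightarrow> F \<omega> x) \<partial>K \<omega> \<partial>P)"
    unfolding N_def
    by (rule nn_integral_distr[OF id], unfold measurable_distr_eq1)
      (rule measurable_compose[OF measurable_prob_algebraD[OF K]
        nn_integral_measurable_subprob_algebra[OF F]])
  also have "\<dots> = (\<integral>\<^sup>+\<omega>. \<integral>\<^sup>+x. F \<omega> x \<partial>k \<omega> \<partial>P)"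
    by (intro nn_integral_cong) (simp add: K_def nn_integral_distr[OF Pair_k] F space_P)
  finally show ?thesis
    by (simp add: k_def)
qed

section \<open>Path laws started from an arbitrary state\<close>

text \<open>
  The Ionescu-Tulcea theorem for the kernels that read off the statistic from the first \<open>n\<close>
  observations. Its finite-dimensional distributions are built by successive composition, which is
  the required formula for the conditional distributions.
\<close>

lemma markov_representation_exists:
  assumes \<zeta>: "(\<lambda>(s, x). \<zeta> s x) \<in> S \<Otimes>\<^sub>M \<mu> \<rightarrow>\<^sub>M S" and \<kappa>: "\<kappa> \<in> S \<rightarrow>\<^sub>M prob_algebra \<mu>"
    and s0: "s0 \<in> space S"
  shows "\<exists>P. markov_representation \<mu> S s0 \<zeta> \<kappa> P"
proof -
  define k where "k n \<omega> = \<kappa> (statistic s0 \<zeta> \<omega> n)" for n \<omega>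
  have stat: "(\<lambda>\<omega>. statistic s0 \<zeta> \<omega> n) \<in> PiM {0..<n} (\<lambda>_. \<mu>) \<rightarrow>\<^sub>M S" for n
    by (rule measurable_statistic[OF \<zeta> s0]) (rule measurable_component_singleton, simp)
  have k: "k n \<in> PiM {0..<n} (\<lambda>_. \<mu>) \<rightarrow>\<^sub>M prob_algebra \<mu>" for n
    unfolding k_def by (rule measurable_compose[OF stat \<kappa>])
  interpret IT: Ionescu_Tulcea k "\<lambda>_. \<mu>"
  proof (rule Ionescu_Tulcea.intro)
    show "k i \<in> PiM {0..<i} (\<lambda>_. \<mu>) \<rightarrow>\<^sub>M subprob_algebra \<mu>" for i
      by (rule measurable_prob_algebraD[OF k])
    show "prob_space (k i x)" if "x \<in> space (PiM {0..<i} (\<lambda>_. \<mu>))" for i x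
      using measurable_space[OF k that] by (simp add: space_prob_algebra)
  qed
  let ?L = IT.PF.lim and ?C = "\<lambda>n. IT.C 0 n (\<lambda>_. undefined)"
  have sets_L: "sets ?L = sets (paths \<mu>)"
    by (rule IT.PF.sets_lim)
  have space_L: "space ?L = space (paths \<mu>)"
    by (rule sets_eq_imp_space_eq[OF sets_L])
  have restr: "(\<lambda>\<omega>. restrict \<omega> {0..<n}) \<in> ?L \<rightarrow>\<^sub>M PiM {0..<n} (\<lambda>_. \<mu>)" for n
    by (simp add: measurable_cong_sets[OF sets_L refl] measurable_restrict)
  have C_eq: "distr ?L (PiM {0..<n} (\<lambda>_. \<mu>)) (\<lambda>\<omega>. restrict \<omega> {0..<n}) = ?C n" for n
  proof (rule measure_eqI)
    fix X assume "X \<in> sets (distr ?L (PiM {0..<n} (\<lambda>_. \<mu>)) (\<lambda>\<omega>. restrict \<omega> {0..<n}))"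
    then have X: "X \<in> sets (PiM {0..<n} (\<lambda>_. \<mu>))" by simp
    moreover have "prod_emb {0..<n} (\<lambda>_. \<mu>) {0..<n} X = X"
      using sets.sets_into_space[OF X] by (intro prod_emb_id) (simp add: space_PiM)
    ultimately show "emeasure (distr ?L (PiM {0..<n} (\<lambda>_. \<mu>)) (\<lambda>\<omega>. restrict \<omega> {0..<n})) X =
        emeasure (?C n) X"
      by (simp add: IT.distr_lim IT.emeasure_CI[of "{0..<n}" n])
  qed (simp add: IT.sets_C)
  have prob: "prob_space ?L"
    by (rule prob_space_distrD[OF restr[of 0]])
      (simp only: C_eq, rule IT.prob_space_C, simp)
  have "emeasure ?L (B \<inter> {\<omega> \<in> space ?L. \<omega> n \<in> A}) =
      (\<integral>\<^sup>+\<omega>\<in>B. emeasure (\<kappa> (statistic s0 \<zeta> \<omega> n)) A \<partial>?L)"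
    if A: "A \<in> sets \<mu>" and B: "B \<in> sets (past \<mu> n)" for n A B
  proof -
    let ?r = "\<lambda>n::nat. \<lambda>\<omega>. restrict \<omega> {0..<n}" and ?Pi = "\<lambda>n::nat. PiM {0..<n} (\<lambda>_. \<mu>)"
    obtain B' where B': "B' \<in> sets (?Pi n)" and B_eq: "B = ?r n -` B' \<inter> space (paths \<mu>)"
    proof -
      have "B \<in> {?r n -` B' \<inter> space (paths \<mu>) | B'. B' \<in> sets (?Pi n)}"
        using B unfolding past_def lessThan_atLeast0
        by (subst (asm) sets_vimage_algebra2) (auto simp: space_PiM)
      then show ?thesis using that by blast
    qed
    \<comment> \<open>The base of the cylinder on the left hand side, in the first \<open>Suc n\<close> coordinates.\<close>
    define X where "X = {h \<in> space (?Pi (Suc n)). restrict h {0..<n} \<in> B' \<and> h n \<in> A}"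
    have rn: "(\<lambda>h. restrict h {0..<n}) \<in> ?Pi (Suc n) \<rightarrow>\<^sub>M ?Pi n"
      by (rule measurable_restrict_subset) auto
    have hn: "(\<lambda>h. h n) \<in> ?Pi (Suc n) \<rightarrow>\<^sub>M \<mu>"
      by (rule measurable_component_singleton) simp
    have X: "X \<in> sets (?Pi (Suc n))"
    proof -
      have "X = ((\<lambda>h. restrict h {0..<n}) -` B' \<inter> space (?Pi (Suc n))) \<inter>
          ((\<lambda>h. h n) -` A \<inter> space (?Pi (Suc n)))"
        by (auto simp: X_def)
      then show ?thesis
        using measurable_sets[OF rn B'] measurable_sets[OF hn A] by auto
    qed
    have undef: "(\<lambda>_. undefined) \<in> space (?Pi 0)"
      by (simp add: space_PiM)
    have stat_restrict: "statistic s0 \<zeta> (?r n \<omega>) m = statistic s0 \<zeta> \<omega> m" if "m \<le> n" for \<omega> m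
      using that by (induction m) auto
    have "B \<inter> {\<omega> \<in> space ?L. \<omega> n \<in> A} = ?r (Suc n) -` X \<inter> space ?L"
    proof -
      have "?r (Suc n) \<omega> \<in> X \<longleftrightarrow> ?r n \<omega> \<in> B' \<and> \<omega> n \<in> A" if "\<omega> \<in> space (paths \<mu>)" for \<omega>
        using that measurable_space[OF restr, of \<omega> "Suc n"]
        by (simp add: X_def restrict_restrict space_L Int_absorb1 del: restrict_apply)
          (simp add: inf_absorb2)
      then show ?thesis
        by (auto simp: B_eq space_L)
    qed
    then have "emeasure ?L (B \<inter> {\<omega> \<in> space ?L. \<omega> n \<in> A}) = emeasure (?C (Suc n)) X"
      unfolding C_eq[symmetric] using X by (simp add: emeasure_distr[OF restr])
    also have "\<dots> = (\<integral>\<^sup>+h. emeasure (IT.eP n h) X \<partial>?C n)"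
      using IT.space_C[OF undef, of n]
      by (simp, subst emeasure_bind[where N="?Pi (Suc n)"])
        (auto simp: X IT.sets_C undef measurable_cong_sets[OF IT.sets_C[OF undef] refl])
    also have "\<dots> = (\<integral>\<^sup>+h. emeasure (k n h) A * indicator B' h \<partial>?C n)"
    proof (rule nn_integral_cong)
      fix h assume "h \<in> space (?C n)"
      then have h: "h \<in> space (?Pi n)"
        by (simp add: IT.space_C[OF undef])
      have "fun_upd h n -` X \<inter> space \<mu> = (if h \<in> B' then A else {})"
      proof -
        have "restrict (h(n := x)) {0..<n} = h" for x
          using h by (auto simp: space_PiM PiE_iff extensional_def)
        moreover have "h(n := x) \<in> space (?Pi (Suc n))" if "x \<in> space \<mu>" for x
          using h that by (auto simp: space_PiM PiE_iff extensional_def less_Suc_eq)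
        ultimately show ?thesis
          using sets.sets_into_space[OF A] by (auto simp: X_def)
      qed
      then show "emeasure (IT.eP n h) X = emeasure (k n h) A * indicator B' h"
        by (simp add: IT.emeasure_eP[OF h X])
    qed
    also have "\<dots> = (\<integral>\<^sup>+\<omega>. emeasure (k n (?r n \<omega>)) A * indicator B' (?r n \<omega>) \<partial>?L)"
      unfolding C_eq[symmetric]
      using A B' measurable_emeasure_kernel[OF measurable_prob_algebraD[OF k[of n]] A]
      by (subst nn_integral_distr[OF restr]) auto
    also have "\<dots> = (\<integral>\<^sup>+\<omega>\<in>B. emeasure (\<kappa> (statistic s0 \<zeta> \<omega> n)) A \<partial>?L)"
      by (intro nn_integral_cong)
        (simp add: k_def stat_restrict B_eq space_L indicator_def del: restrict_apply)
    finally show ?thesis .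
  qed
  then have "markov_representation \<mu> S s0 \<zeta> \<kappa> ?L"
    unfolding markov_representation_def using s0 \<zeta> \<kappa> prob sets_L by blast
  then show ?thesis ..
qed

text \<open>
  Integrating out the last observation turns \<open>u (Suc m)\<close> into \<open>u m\<close>, so an expectation over the
  path can be computed backwards, one kernel at a time. This serves both for probabilities of
  cylinders and for the continuation value of a policy.
\<close>

lemma backward_iteration:
  fixes a :: "nat \<Rightarrow> 's \<Rightarrow> 'x \<Rightarrow> ennreal"
  assumes rep: "markov_representation \<mu> S s0 \<zeta> \<kappa> P"
    and a: "\<And>m. m < n \<Longrightarrow> (\<lambda>(s, x). a m s x) \<in> borel_measurable (S \<Otimes>\<^sub>M \<mu>)"
    and u: "\<And>m. m \<le> n \<Longrightarrow> u m \<in> borel_measurable S"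
    and step: "\<And>m s. m < n \<Longrightarrow> s \<in> space S \<Longrightarrow>
      u m s = (\<integral>\<^sup>+x. a m s x * u (Suc m) (\<zeta> s x) \<partial>\<kappa> s)"
  shows "(\<integral>\<^sup>+\<omega>. (\<Prod>i<n. a i (statistic s0 \<zeta> \<omega> i) (\<omega> i)) * u n (statistic s0 \<zeta> \<omega> n) \<partial>P) = u 0 s0"
proof -
  from rep have s0: "s0 \<in> space S" and \<zeta>[measurable]: "(\<lambda>(s, x). \<zeta> s x) \<in> S \<Otimes>\<^sub>M \<mu> \<rightarrow>\<^sub>M S"
    and \<kappa>: "\<kappa> \<in> S \<rightarrow>\<^sub>M prob_algebra \<mu>" and P: "prob_space P"
    and sets_P: "sets P = sets (paths \<mu>)"
    by (auto simp: markov_representation_def)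
  interpret P: prob_space P by (rule P)
  let ?s = "\<lambda>m \<omega>. statistic s0 \<zeta> \<omega> m"
  define W where "W m \<omega> = (\<Prod>i<m. a i (?s i \<omega>) (\<omega> i))" for m \<omega>
  have "(\<integral>\<^sup>+\<omega>. W m \<omega> * u m (?s m \<omega>) \<partial>P) = u 0 s0" if "m \<le> n" for m
    using that
  proof (induction m)
    case 0
    then show ?case by (simp add: W_def P.emeasure_space_1)
  next
    case (Suc m)
    have m: "m < n" using Suc by simp
    have sm[measurable]: "?s m \<in> past \<mu> m \<rightarrow>\<^sub>M S"
      by (rule measurable_statistic_past[OF \<zeta> s0 order.refl])
    have am[measurable]: "(\<lambda>(s, x). a m s x) \<in> borel_measurable (S \<Otimes>\<^sub>M \<mu>)"
      and um[measurable]: "u (Suc m) \<in> borel_measurable S"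
      using Suc by (auto intro: a u)
    have W[measurable]: "W m \<in> borel_measurable (past \<mu> m)"
      unfolding W_def
    proof (intro borel_measurable_prod_ennreal)
      fix i assume i: "i \<in> {..<m}"
      have [measurable]: "?s i \<in> past \<mu> m \<rightarrow>\<^sub>M S" "(\<lambda>\<omega>. \<omega> i) \<in> past \<mu> m \<rightarrow>\<^sub>M \<mu>"
        "(\<lambda>(s, x). a i s x) \<in> borel_measurable (S \<Otimes>\<^sub>M \<mu>)"
        using i m by (auto intro!: measurable_statistic_past[OF \<zeta> s0] measurable_past_component a)
      show "(\<lambda>\<omega>. a i (?s i \<omega>) (\<omega> i)) \<in> borel_measurable (past \<mu> m)"
        by measurable
    qed
    have "(\<integral>\<^sup>+\<omega>. W (Suc m) \<omega> * u (Suc m) (?s (Suc m) \<omega>) \<partial>P) =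
      (\<integral>\<^sup>+\<omega>. W m \<omega> * (a m (?s m \<omega>) (\<omega> m) * u (Suc m) (\<zeta> (?s m \<omega>) (\<omega> m))) \<partial>P)"
      by (simp add: W_def mult.assoc)
    also have "\<dots> = (\<integral>\<^sup>+\<omega>. \<integral>\<^sup>+x. W m \<omega> * (a m (?s m \<omega>) x * u (Suc m) (\<zeta> (?s m \<omega>) x))
        \<partial>\<kappa> (?s m \<omega>) \<partial>P)"
      by (rule disintegration[OF rep]) measurable
    also have "\<dots> = (\<integral>\<^sup>+\<omega>. W m \<omega> * u m (?s m \<omega>) \<partial>P)"
    proof (rule nn_integral_cong)
      fix \<omega> assume "\<omega> \<in> space P"
      then have s: "?s m \<omega> \<in> space S"
        using statistic_in_space[OF \<zeta> s0] sets_eq_imp_space_eq[OF sets_P] by auto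
      have sets: "sets (\<kappa> (?s m \<omega>)) = sets \<mu>"
        using measurable_space[OF \<kappa> s] by (simp add: space_prob_algebra)
      have "(\<lambda>x. a m (?s m \<omega>) x * u (Suc m) (\<zeta> (?s m \<omega>) x)) \<in> borel_measurable \<mu>"
        using s by measurable
      then show "(\<integral>\<^sup>+x. W m \<omega> * (a m (?s m \<omega>) x * u (Suc m) (\<zeta> (?s m \<omega>) x)) \<partial>\<kappa> (?s m \<omega>)) =
          W m \<omega> * u m (?s m \<omega>)"
        unfolding step[OF m s]
        by (intro nn_integral_cmult) (simp add: measurable_cong_sets[OF sets refl])
    qed
    also have "\<dots> = u 0 s0"
      using Suc by simp
    finally show ?case .
  qed
  from this[of n] show ?thesis
    by (simp add: W_def)
qed

text \<open>
  The probability that the next observations fall into the listed sets, from state \<open>s\<close>. Defining it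
  by recursion from the front exhibits its measurable dependence on \<open>s\<close>.
\<close>

primrec cylinder_prob ::
  "('s \<Rightarrow> 'x \<Rightarrow> 's) \<Rightarrow> ('s \<Rightarrow> 'x measure) \<Rightarrow> 'x set list \<Rightarrow> 's \<Rightarrow> ennreal" where
  "cylinder_prob \<zeta> \<kappa> [] s = 1"
| "cylinder_prob \<zeta> \<kappa> (A # As) s = (\<integral>\<^sup>+x. indicator A x * cylinder_prob \<zeta> \<kappa> As (\<zeta> s x) \<partial>\<kappa> s)"

definition cylinder :: "'x measure \<Rightarrow> 'x set list \<Rightarrow> (nat \<Rightarrow> 'x) set" where
  "cylinder \<mu> As = {\<omega> \<in> space (paths \<mu>). \<forall>i<length As. \<omega> i \<in> As ! i}"

lemma sets_cylinder:
  assumes "set As \<subseteq> sets \<mu>"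
  shows "cylinder \<mu> As \<in> sets (paths \<mu>)"
proof -
  have "cylinder \<mu> As = {\<omega> \<in> space (paths \<mu>). \<forall>i\<in>{..<length As}. \<omega> i \<in> As ! i}"
    by (auto simp: cylinder_def)
  also have "\<dots> \<in> sets (paths \<mu>)"
  proof (rule sets.sets_Collect_finite_All)
    fix i assume "i \<in> {..<length As}"
    then have [measurable]: "As ! i \<in> sets \<mu>" using assms by auto
    show "{\<omega> \<in> space (paths \<mu>). \<omega> i \<in> As ! i} \<in> sets (paths \<mu>)" by measurable
  qed simp
  finally show ?thesis .
qed

lemma measurable_cylinder_prob:
  assumes \<zeta>[measurable]: "(\<lambda>(s, x). \<zeta> s x) \<in> S \<Otimes>\<^sub>M \<mu> \<rightarrow>\<^sub>M S"
    and \<kappa>: "\<kappa> \<in> S \<rightarrow>\<^sub>M prob_algebra \<mu>" and "set As \<subseteq> sets \<mu>"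
  shows "cylinder_prob \<zeta> \<kappa> As \<in> borel_measurable S"
  using assms(3)
proof (induction As)
  case (Cons A As)
  have [measurable]: "A \<in> sets \<mu>" "cylinder_prob \<zeta> \<kappa> As \<in> borel_measurable S"
    using Cons by auto
  show ?case
    unfolding cylinder_prob.simps
    by (rule nn_integral_measurable_subprob_algebra2[OF _ measurable_prob_algebraD[OF \<kappa>]]) measurable
next
  case Nil
  have "cylinder_prob \<zeta> \<kappa> [] = (\<lambda>_. 1)" by (rule ext) simp
  then show ?case by simp
qed

lemma emeasure_cylinder:
  assumes rep: "markov_representation \<mu> S s0 \<zeta> \<kappa> P" and As: "set As \<subseteq> sets \<mu>"
  shows "emeasure P (cylinder \<mu> As) = cylinder_prob \<zeta> \<kappa> As s0"
proof -
  have \<zeta>: "(\<lambda>(s, x). \<zeta> s x) \<in> S \<Otimes>\<^sub>M \<mu> \<rightarrow>\<^sub>M S" and \<kappa>: "\<kappa> \<in> S \<rightarrow>\<^sub>M prob_algebra \<mu>"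
    and sets_P: "sets P = sets (paths \<mu>)"
    using rep by (auto simp: markov_representation_def)
  let ?n = "length As"
  have "emeasure P (cylinder \<mu> As) = (\<integral>\<^sup>+\<omega>. indicator (cylinder \<mu> As) \<omega> \<partial>P)"
    using sets_cylinder[OF As] by (simp add: sets_P)
  also have "\<dots> = (\<integral>\<^sup>+\<omega>. (\<Prod>i<?n. indicator (As ! i) (\<omega> i)) *
      cylinder_prob \<zeta> \<kappa> (drop ?n As) (statistic s0 \<zeta> \<omega> ?n) \<partial>P)"
    by (intro nn_integral_cong)
      (auto simp: cylinder_def sets_eq_imp_space_eq[OF sets_P] indicator_def)
  also have "\<dots> = cylinder_prob \<zeta> \<kappa> (drop 0 As) s0"
  proof (rule backward_iteration[OF rep, where a="\<lambda>m s x. indicator (As ! m) x"])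
    fix m assume "m < ?n"
    then have [measurable]: "As ! m \<in> sets \<mu>" using As by auto
    show "(\<lambda>(s, x). indicator (As ! m) x) \<in> borel_measurable (S \<Otimes>\<^sub>M \<mu>)" by measurable
    show "cylinder_prob \<zeta> \<kappa> (drop m As) s =
        (\<integral>\<^sup>+x. indicator (As ! m) x * cylinder_prob \<zeta> \<kappa> (drop (Suc m) As) (\<zeta> s x) \<partial>\<kappa> s)" for s
      using \<open>m < ?n\<close> by (subst Cons_nth_drop_Suc[symmetric]) simp_all
  next
    show "cylinder_prob \<zeta> \<kappa> (drop m As) \<in> borel_measurable S" for m
      using As by (intro measurable_cylinder_prob[OF \<zeta> \<kappa>]) (meson set_drop_subset subset_trans)
  qed
  finally show ?thesis by simp
qed

text \<open>
  The basic sets of the product sigma-algebra restrict finitely many coordinates, not necessarily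
  an initial segment; padding with the whole space makes them cylinders.
\<close>

lemma prod_emb_eq_cylinder:
  assumes "finite J" "\<And>i. i \<in> J \<Longrightarrow> A i \<in> sets \<mu>"
  shows "\<exists>As. set As \<subseteq> sets \<mu> \<and> prod_emb UNIV (\<lambda>_. \<mu>) J (Pi\<^sub>E J A) = cylinder \<mu> As"
proof -
  obtain n where n: "J \<subseteq> {..<n}"
    using finite_nat_iff_bounded assms(1) by auto
  let ?As = "map (\<lambda>i. if i \<in> J then A i else space \<mu>) [0..<n]"
  have "\<omega> \<in> prod_emb UNIV (\<lambda>_. \<mu>) J (Pi\<^sub>E J A) \<longleftrightarrow> \<omega> \<in> cylinder \<mu> ?As" for \<omega>
    using n by (auto simp: prod_emb_iff cylinder_def space_PiM PiE_iff)
  moreover have "set ?As \<subseteq> sets \<mu>"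
    using assms by auto
  ultimately show ?thesis by blast
qed

lemma measure_eqI_cylinder:
  assumes "sets P = sets (paths \<mu>)" "sets Q = sets (paths \<mu>)" "finite_measure P"
    and eq: "\<And>As. set As \<subseteq> sets \<mu> \<Longrightarrow> emeasure P (cylinder \<mu> As) = emeasure Q (cylinder \<mu> As)"
  shows "P = Q"
proof (rule measure_eqI_PiM_infinite[OF assms(1,2) _ assms(3)])
  fix A :: "nat \<Rightarrow> 'a set" and J assume "finite J" "\<And>i. i \<in> J \<Longrightarrow> A i \<in> sets \<mu>"
  then obtain As where As: "set As \<subseteq> sets \<mu>"
    and eq_As: "prod_emb UNIV (\<lambda>_. \<mu>) J (Pi\<^sub>E J A) = cylinder \<mu> As"
    using prod_emb_eq_cylinder[of J A \<mu>] by blast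
  show "emeasure P (prod_emb UNIV (\<lambda>_. \<mu>) J (Pi\<^sub>E J A)) = emeasure Q (prod_emb UNIV (\<lambda>_. \<mu>) J (Pi\<^sub>E J A))"
    unfolding eq_As by (rule eq[OF As])
qed

text \<open>
  The law of the observations if the chain is started in \<open>s\<close>. It is the only one with this
  representation, so the choice is harmless.
\<close>

definition path_law ::
  "'x measure \<Rightarrow> 's measure \<Rightarrow> ('s \<Rightarrow> 'x \<Rightarrow> 's) \<Rightarrow> ('s \<Rightarrow> 'x measure) \<Rightarrow> 's \<Rightarrow> (nat \<Rightarrow> 'x) measure" where
  "path_law \<mu> S \<zeta> \<kappa> s = (SOME P. markov_representation \<mu> S s \<zeta> \<kappa> P)"

lemma markov_representation_path_law:
  assumes "(\<lambda>(s, x). \<zeta> s x) \<in> S \<Otimes>\<^sub>M \<mu> \<rightarrow>\<^sub>M S" "\<kappa> \<in> S \<rightarrow>\<^sub>M prob_algebra \<mu>" "s \<in> space S"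
  shows "markov_representation \<mu> S s \<zeta> \<kappa> (path_law \<mu> S \<zeta> \<kappa> s)"
  unfolding path_law_def by (rule someI_ex) (rule markov_representation_exists[OF assms])

lemma path_law_unique:
  assumes rep: "markov_representation \<mu> S s \<zeta> \<kappa> P"
  shows "P = path_law \<mu> S \<zeta> \<kappa> s"
proof -
  have rep': "markov_representation \<mu> S s \<zeta> \<kappa> (path_law \<mu> S \<zeta> \<kappa> s)"
    unfolding path_law_def by (rule someI) (rule rep)
  note props = rep[unfolded markov_representation_def] rep'[unfolded markov_representation_def]
  show ?thesis
  proof (rule measure_eqI_cylinder)
    show "sets P = sets (paths \<mu>)" "sets (path_law \<mu> S \<zeta> \<kappa> s) = sets (paths \<mu>)"
      "finite_measure P"
      using props by (blast intro: prob_space.finite_measure)+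
    fix As assume "set As \<subseteq> sets \<mu>"
    then show "emeasure P (cylinder \<mu> As) = emeasure (path_law \<mu> S \<zeta> \<kappa> s) (cylinder \<mu> As)"
      by (simp only: emeasure_cylinder[OF rep] emeasure_cylinder[OF rep'])
  qed
qed

text \<open>
  Measurability in the initial state needs to be checked on cylinders only, where the probability
  is given by the recursion \<open>cylinder_prob\<close>.
\<close>

lemma measurable_path_law:
  assumes \<zeta>: "(\<lambda>(s, x). \<zeta> s x) \<in> S \<Otimes>\<^sub>M \<mu> \<rightarrow>\<^sub>M S" and \<kappa>: "\<kappa> \<in> S \<rightarrow>\<^sub>M prob_algebra \<mu>"
  shows "path_law \<mu> S \<zeta> \<kappa> \<in> S \<rightarrow>\<^sub>M prob_algebra (paths \<mu>)"
proof (rule measurable_prob_algebra_generated[OF sets_PiM Int_stable_prod_algebra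
      prod_algebra_sets_into_space])
  fix s assume "s \<in> space S"
  note rep = markov_representation_path_law[OF \<zeta> \<kappa> this]
  show "prob_space (path_law \<mu> S \<zeta> \<kappa> s)" "sets (path_law \<mu> S \<zeta> \<kappa> s) = sets (paths \<mu>)"
    using rep by (auto simp: markov_representation_def)
next
  fix X :: "(nat \<Rightarrow> 'b) set" assume "X \<in> prod_algebra UNIV (\<lambda>_. \<mu>)"
  then obtain J A where J: "finite J" "\<And>i. i \<in> J \<Longrightarrow> A i \<in> sets \<mu>"
    and X: "X = prod_emb UNIV (\<lambda>_. \<mu>) J (Pi\<^sub>E J A)"
    by (elim prod_algebraE) auto
  obtain As where As: "set As \<subseteq> sets \<mu>" "X = cylinder \<mu> As"
    using prod_emb_eq_cylinder[of J A \<mu>] J X by blast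
  have "(\<lambda>s. emeasure (path_law \<mu> S \<zeta> \<kappa> s) X) \<in> borel_measurable S \<longleftrightarrow>
      cylinder_prob \<zeta> \<kappa> As \<in> borel_measurable S"
    unfolding As(2)
    by (intro measurable_cong emeasure_cylinder[OF markov_representation_path_law[OF \<zeta> \<kappa>] As(1)])
  then show "(\<lambda>s. emeasure (path_law \<mu> S \<zeta> \<kappa> s) X) \<in> borel_measurable S"
    using measurable_cylinder_prob[OF \<zeta> \<kappa> As(1)] by simp
qed

text \<open>
  The Markov property at time 1: draw the first observation, then restart the chain in the updated
  state. By uniqueness it suffices to compare cylinders, and there the claim is the recursion
  equation of \<open>cylinder_prob\<close>.
\<close>

lemma path_law_step:
  assumes \<zeta>: "(\<lambda>(s, x). \<zeta> s x) \<in> S \<Otimes>\<^sub>M \<mu> \<rightarrow>\<^sub>M S" and \<kappa>: "\<kappa> \<in> S \<rightarrow>\<^sub>M prob_algebra \<mu>"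
    and s: "s \<in> space S"
  shows "path_law \<mu> S \<zeta> \<kappa> s =
    \<kappa> s \<bind> (\<lambda>x. distr (path_law \<mu> S \<zeta> \<kappa> (\<zeta> s x)) (paths \<mu>) (case_nat x))"
    and "(\<lambda>x. distr (path_law \<mu> S \<zeta> \<kappa> (\<zeta> s x)) (paths \<mu>) (case_nat x)) \<in>
      \<mu> \<rightarrow>\<^sub>M prob_algebra (paths \<mu>)"
proof -
  let ?L = "path_law \<mu> S \<zeta> \<kappa>"
  let ?K = "\<lambda>x. distr (?L (\<zeta> s x)) (paths \<mu>) (case_nat x)"
  note [measurable] = \<zeta> measurable_path_law[OF \<zeta> \<kappa>]
  have shift: "(\<lambda>(x, \<omega>). case_nat x \<omega>) \<in> \<mu> \<Otimes>\<^sub>M paths \<mu> \<rightarrow>\<^sub>M paths \<mu>"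
  proof (rule measurable_PiM_single')
    show "(\<lambda>y. (case y of (x, \<omega>) \<Rightarrow> case_nat x \<omega>) i) \<in> \<mu> \<Otimes>\<^sub>M paths \<mu> \<rightarrow>\<^sub>M \<mu>" for i
      by (cases i) (auto simp: split_beta')
  qed (auto simp: space_pair_measure space_PiM PiE_iff split: nat.split)
  have K: "?K \<in> \<mu> \<rightarrow>\<^sub>M prob_algebra (paths \<mu>)"
    using s by (intro measurable_distr_prob_space2[OF _ shift]) measurable
  then show "?K \<in> \<mu> \<rightarrow>\<^sub>M prob_algebra (paths \<mu>)" .
  note rep = markov_representation_path_law[OF \<zeta> \<kappa>]
  have \<kappa>s: "\<kappa> s \<in> space (prob_algebra \<mu>)"
    by (rule measurable_space[OF \<kappa> s])
  then have space_\<kappa>s: "space (\<kappa> s) = space \<mu>"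
    by (auto simp: space_prob_algebra dest: sets_eq_imp_space_eq)
  show "?L s = \<kappa> s \<bind> ?K"
  proof (rule measure_eqI_cylinder)
    show "sets (?L s) = sets (paths \<mu>)" "finite_measure (?L s)"
      using rep[OF s] by (auto simp: markov_representation_def intro: prob_space.finite_measure)
    show "sets (\<kappa> s \<bind> ?K) = sets (paths \<mu>)"
      by (rule sets_bind'[OF \<kappa>s K])
    fix As assume As: "set As \<subseteq> sets \<mu>"
    have "emeasure (?K x) (cylinder \<mu> As) = (case As of [] \<Rightarrow> 1
        | A # As' \<Rightarrow> indicator A x * cylinder_prob \<zeta> \<kappa> As' (\<zeta> s x))" if x: "x \<in> space \<mu>" for x
    proof -
      have \<zeta>sx: "\<zeta> s x \<in> space S"
        using measurable_space[OF \<zeta>, of "(s, x)"] s x by (simp add: space_pair_measure)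
      note rep' = rep[OF \<zeta>sx]
      have sets: "sets (?L (\<zeta> s x)) = sets (paths \<mu>)" and prob: "prob_space (?L (\<zeta> s x))"
        using rep' by (auto simp: markov_representation_def)
      note space = sets_eq_imp_space_eq[OF sets]
      have "case_nat x \<in> ?L (\<zeta> s x) \<rightarrow>\<^sub>M paths \<mu>"
        using measurable_compose[OF measurable_Pair1'[OF x] shift]
        by (simp add: measurable_cong_sets[OF sets refl])
      then have "emeasure (?K x) (cylinder \<mu> As) =
          emeasure (?L (\<zeta> s x)) (case_nat x -` cylinder \<mu> As \<inter> space (paths \<mu>))"
        using sets_cylinder[OF As] by (simp add: emeasure_distr space)
      also have "\<dots> = (case As of [] \<Rightarrow> 1
        | A # As' \<Rightarrow> indicator A x * cylinder_prob \<zeta> \<kappa> As' (\<zeta> s x))"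
      proof (cases As)
        case Nil
        then have "case_nat x -` cylinder \<mu> As \<inter> space (paths \<mu>) = space (?L (\<zeta> s x))"
          using x by (auto simp: cylinder_def space_PiM PiE_iff space split: nat.split)
        then show ?thesis
          using prob by (simp add: Nil prob_space.emeasure_space_1)
      next
        case (Cons A As')
        then have "case_nat x -` cylinder \<mu> As \<inter> space (paths \<mu>) = (if x \<in> A then cylinder \<mu> As' else {})"
          using x by (auto simp: cylinder_def space_PiM PiE_iff less_Suc_eq_0_disj split: nat.split)
        then show ?thesis
          using As emeasure_cylinder[OF rep', of As'] by (simp add: Cons)
      qed
      finally show ?thesis .
    qed
    then have "emeasure (\<kappa> s \<bind> ?K) (cylinder \<mu> As) = (\<integral>\<^sup>+x. (case As of [] \<Rightarrow> 1
        | A # As' \<Rightarrow> indicator A x * cylinder_prob \<zeta> \<kappa> As' (\<zeta> s x)) \<partial>\<kappa> s)"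
      unfolding emeasure_bind_prob_algebra[OF \<kappa>s K sets_cylinder[OF As]]
      by (intro nn_integral_cong) (simp add: space_\<kappa>s)
    also have "\<dots> = cylinder_prob \<zeta> \<kappa> As s"
      using \<kappa>s by (cases As) (auto simp: space_prob_algebra prob_space.emeasure_space_1)
    finally show "emeasure (?L s) (cylinder \<mu> As) = emeasure (\<kappa> s \<bind> ?K) (cylinder \<mu> As)"
      using emeasure_cylinder[OF rep[OF s] As] by simp
  qed
qed

text \<open>
  The event \<open>R\<close> may be nonmeasurable: it is covered by a measurable null set, to which Fubini for
  \<open>path_law_step\<close> applies. That the exceptional set lives on paths matters. A null set of paths
  need not project to a null set of states, so the corresponding claim for the law of the state
  alone may fail.
\<close>

lemma AE_path_law_step:
  assumes \<zeta>: "(\<lambda>(s, x). \<zeta> s x) \<in> S \<Otimes>\<^sub>M \<mu> \<rightarrow>\<^sub>M S" and \<kappa>: "\<kappa> \<in> S \<rightarrow>\<^sub>M prob_algebra \<mu>"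
    and s: "s \<in> space S" and ae: "AE \<omega> in path_law \<mu> S \<zeta> \<kappa> s. R \<omega>"
  shows "AE x in \<kappa> s. AE \<omega> in path_law \<mu> S \<zeta> \<kappa> (\<zeta> s x). R (case_nat x \<omega>)"
proof -
  let ?L = "path_law \<mu> S \<zeta> \<kappa>"
  let ?K = "\<lambda>x. distr (?L (\<zeta> s x)) (paths \<mu>) (case_nat x)"
  note step = path_law_step[OF \<zeta> \<kappa> s]
  have \<kappa>s: "sets (\<kappa> s) = sets \<mu>"
    using measurable_space[OF \<kappa> s] by (simp add: space_prob_algebra)
  have K: "?K \<in> \<kappa> s \<rightarrow>\<^sub>M subprob_algebra (paths \<mu>)"
    using measurable_prob_algebraD[OF step(2)] by (simp add: measurable_cong_sets[OF \<kappa>s refl])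
  have sets_L: "sets (?L s') = sets (paths \<mu>)" if "s' \<in> space S" for s'
    using measurable_space[OF measurable_path_law[OF \<zeta> \<kappa>] that] by (simp add: space_prob_algebra)
  obtain N where N: "{\<omega> \<in> space (?L s). \<not> R \<omega>} \<subseteq> N" "N \<in> sets (?L s)" "emeasure (?L s) N = 0"
    using ae by (rule AE_E)
  have N_sets[measurable]: "N \<in> sets (paths \<mu>)"
    using N(2) sets_L[OF s] by simp
  have "AE \<omega> in ?L s. \<omega> \<notin> N"
    using N by (intro AE_not_in) auto
  then have "AE x in \<kappa> s. AE \<omega> in ?K x. \<omega> \<notin> N"
    unfolding step(1) by (subst (asm) AE_bind[OF K]) auto
  moreover have "AE x in \<kappa> s. x \<in> space \<mu>"
    using sets_eq_imp_space_eq[OF \<kappa>s] by (auto intro: AE_I2)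
  ultimately show ?thesis
  proof eventually_elim
    fix x assume *: "AE \<omega> in ?K x. \<omega> \<notin> N" and x: "x \<in> space \<mu>"
    have \<zeta>sx: "\<zeta> s x \<in> space S"
      using measurable_space[OF \<zeta>, of "(s, x)"] s x by (simp add: space_pair_measure)
    note sets = sets_L[OF \<zeta>sx]
    have shift: "case_nat x \<omega> \<in> space (paths \<mu>)" if "\<omega> \<in> space (paths \<mu>)" for \<omega>
      using that x by (auto simp: space_PiM PiE_iff split: nat.split)
    have meas: "case_nat x \<in> ?L (\<zeta> s x) \<rightarrow>\<^sub>M paths \<mu>"
      unfolding measurable_cong_sets[OF sets refl]
    proof (rule measurable_PiM_single')
      show "(\<lambda>\<omega>. case_nat x \<omega> i) \<in> paths \<mu> \<rightarrow>\<^sub>M \<mu>" for i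
        using x by (cases i) auto
    qed (use shift in \<open>auto simp: space_PiM\<close>)
    have "AE \<omega> in ?L (\<zeta> s x). case_nat x \<omega> \<notin> N"
      using * by (subst (asm) AE_distr_iff[OF meas]) auto
    then show "AE \<omega> in ?L (\<zeta> s x). R (case_nat x \<omega>)"
    proof (rule AE_mp, intro AE_I2 impI)
      fix \<omega> assume \<omega>: "\<omega> \<in> space (?L (\<zeta> s x))" and notin: "case_nat x \<omega> \<notin> N"
      have "case_nat x \<omega> \<in> space (?L s)"
        using \<omega> shift sets_eq_imp_space_eq[OF sets] sets_eq_imp_space_eq[OF sets_L[OF s]] by simp
      with N(1) notin show "R (case_nat x \<omega>)" by blast
    qed
  qed
qed

section \<open>Total cost and the Bellman equation\<close>

text \<open>
  Being in state \<open>s\<close> costs \<open>a s\<close>, and the process survives to the next step with probability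
  \<open>b s\<close>; the distribution of the observation is chosen from \<open>D s\<close> so as to maximize the cost.
\<close>

definition bellman ::
  "('s \<Rightarrow> ennreal) \<Rightarrow> ('s \<Rightarrow> ennreal) \<Rightarrow> ('s \<Rightarrow> 'x \<Rightarrow> 's) \<Rightarrow> ('s \<Rightarrow> 'x measure set) \<Rightarrow>
   ('s \<Rightarrow> ennreal) \<Rightarrow> 's \<Rightarrow> ennreal" where
  "bellman a b \<zeta> D f s = a s + b s * (SUP H\<in>D s. \<integral>\<^sup>+x. f (\<zeta> s x) \<partial>H)"

definition survival :: "('s \<Rightarrow> ennreal) \<Rightarrow> (nat \<Rightarrow> 's) \<Rightarrow> nat \<Rightarrow> ennreal" where
  "survival b \<sigma> n = (\<Prod>i<n. b (\<sigma> i))"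

definition total_cost ::
  "('s \<Rightarrow> ennreal) \<Rightarrow> ('s \<Rightarrow> ennreal) \<Rightarrow> 's \<Rightarrow> ('s \<Rightarrow> 'x \<Rightarrow> 's) \<Rightarrow> (nat \<Rightarrow> 'x) measure \<Rightarrow> ennreal" where
  "total_cost a b s0 \<zeta> P = (\<integral>\<^sup>+\<omega>. (\<Sum>n. survival b (statistic s0 \<zeta> \<omega>) n * a (statistic s0 \<zeta> \<omega> n)) \<partial>P)"

lemma measurable_survival_past:
  assumes "(\<lambda>(s, x). \<zeta> s x) \<in> S \<Otimes>\<^sub>M \<mu> \<rightarrow>\<^sub>M S" "s0 \<in> space S" "b \<in> borel_measurable S"
  shows "(\<lambda>\<omega>. survival b (statistic s0 \<zeta> \<omega>) n) \<in> borel_measurable (past \<mu> n)"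
  unfolding survival_def
  by (rule borel_measurable_prod_ennreal)
    (auto intro!: measurable_compose[OF measurable_statistic_past[OF assms(1,2)] assms(3)])

text \<open>
  The statistics \<open>\<zeta>'\<close> of the representation and \<open>\<zeta>\<close> of the cost are kept apart, because an adversary
  may use more of the past than the test does.
\<close>

lemma survival_weighted_step:
  assumes rep: "markov_representation \<mu> S' s0' \<zeta>' \<kappa> P"
    and \<zeta>[measurable]: "(\<lambda>(s, x). \<zeta> s x) \<in> S \<Otimes>\<^sub>M \<mu> \<rightarrow>\<^sub>M S" and s0: "s0 \<in> space S"
    and [measurable]: "a \<in> borel_measurable S" "b \<in> borel_measurable S" "v \<in> borel_measurable S"
  shows "(\<integral>\<^sup>+\<omega>. survival b (statistic s0 \<zeta> \<omega>) n * a (statistic s0 \<zeta> \<omega> n) \<partial>P) +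
      (\<integral>\<^sup>+\<omega>. survival b (statistic s0 \<zeta> \<omega>) (Suc n) * v (statistic s0 \<zeta> \<omega> (Suc n)) \<partial>P) =
    (\<integral>\<^sup>+\<omega>. survival b (statistic s0 \<zeta> \<omega>) n * (a (statistic s0 \<zeta> \<omega> n) +
      b (statistic s0 \<zeta> \<omega> n) *
        (\<integral>\<^sup>+x. v (\<zeta> (statistic s0 \<zeta> \<omega> n) x) \<partial>\<kappa> (statistic s0' \<zeta>' \<omega> n))) \<partial>P)"
proof -
  from rep have s0': "s0' \<in> space S'" and \<zeta>': "(\<lambda>(s, x). \<zeta>' s x) \<in> S' \<Otimes>\<^sub>M \<mu> \<rightarrow>\<^sub>M S'"
    and \<kappa>: "\<kappa> \<in> S' \<rightarrow>\<^sub>M prob_algebra \<mu>" and sets_P: "sets P = sets (paths \<mu>)"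
    by (auto simp: markov_representation_def)
  let ?s = "\<lambda>\<omega>. statistic s0 \<zeta> \<omega> n" and ?W = "\<lambda>\<omega>. survival b (statistic s0 \<zeta> \<omega>) n"
  have s[measurable]: "?s \<in> past \<mu> n \<rightarrow>\<^sub>M S"
    by (rule measurable_statistic_past[OF \<zeta> s0 order.refl])
  have W[measurable]: "?W \<in> borel_measurable (past \<mu> n)"
    by (rule measurable_survival_past[OF \<zeta> s0]) measurable
  have P_meas: "f \<in> borel_measurable P" if "f \<in> borel_measurable (past \<mu> n)" for f :: "_ \<Rightarrow> ennreal"
    using measurable_from_past[OF that] by (simp add: measurable_cong_sets[OF sets_P refl])
  have "(\<lambda>\<omega>. ?W \<omega> * a (?s \<omega>)) \<in> borel_measurable P"
    by (rule P_meas) measurable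
  moreover have "(\<lambda>\<omega>. ?W \<omega> * b (?s \<omega>) * v (\<zeta> (?s \<omega>) (\<omega> n))) \<in> borel_measurable P"
  proof -
    have [measurable]: "?W \<in> borel_measurable P" "?s \<in> P \<rightarrow>\<^sub>M S" "(\<lambda>\<omega>. \<omega> n) \<in> P \<rightarrow>\<^sub>M \<mu>"
      using measurable_from_past[OF W] measurable_from_past[OF s]
      by (simp_all add: measurable_cong_sets[OF sets_P refl])
    show ?thesis by measurable
  qed
  ultimately have "(\<integral>\<^sup>+\<omega>. ?W \<omega> * a (?s \<omega>) \<partial>P) +
      (\<integral>\<^sup>+\<omega>. survival b (statistic s0 \<zeta> \<omega>) (Suc n) * v (statistic s0 \<zeta> \<omega> (Suc n)) \<partial>P) =
      (\<integral>\<^sup>+\<omega>. ?W \<omega> * a (?s \<omega>) + ?W \<omega> * b (?s \<omega>) * v (\<zeta> (?s \<omega>) (\<omega> n)) \<partial>P)"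
    by (subst nn_integral_add) (auto simp: survival_def)
  also have "\<dots> = (\<integral>\<^sup>+\<omega>. \<integral>\<^sup>+x. ?W \<omega> * a (?s \<omega>) + ?W \<omega> * b (?s \<omega>) * v (\<zeta> (?s \<omega>) x)
      \<partial>\<kappa> (statistic s0' \<zeta>' \<omega> n) \<partial>P)"
    by (rule disintegration[OF rep]) measurable
  also have "\<dots> = (\<integral>\<^sup>+\<omega>. ?W \<omega> * (a (?s \<omega>) + b (?s \<omega>) *
        (\<integral>\<^sup>+x. v (\<zeta> (?s \<omega>) x) \<partial>\<kappa> (statistic s0' \<zeta>' \<omega> n))) \<partial>P)"
  proof (rule nn_integral_cong)
    fix \<omega> assume "\<omega> \<in> space P"
    then have \<omega>: "\<omega> \<in> space (paths \<mu>)"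
      using sets_eq_imp_space_eq[OF sets_P] by simp
    let ?k = "\<kappa> (statistic s0' \<zeta>' \<omega> n)"
    have sets: "sets ?k = sets \<mu>" and prob: "prob_space ?k"
      using measurable_space[OF \<kappa> statistic_in_space[OF \<zeta>' s0' \<omega>]] by (simp_all add: space_prob_algebra)
    have "?s \<omega> \<in> space S"
      by (rule statistic_in_space[OF \<zeta> s0 \<omega>])
    then have "(\<lambda>x. v (\<zeta> (?s \<omega>) x)) \<in> borel_measurable \<mu>"
      by measurable
    then have [measurable]: "(\<lambda>x. v (\<zeta> (?s \<omega>) x)) \<in> borel_measurable ?k"
      by (simp add: measurable_cong_sets[OF sets refl])
    show "(\<integral>\<^sup>+x. ?W \<omega> * a (?s \<omega>) + ?W \<omega> * b (?s \<omega>) * v (\<zeta> (?s \<omega>) x) \<partial>?k) =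
        ?W \<omega> * (a (?s \<omega>) + b (?s \<omega>) * (\<integral>\<^sup>+x. v (\<zeta> (?s \<omega>) x) \<partial>?k))"
      by (subst nn_integral_add)
        (auto simp: nn_integral_cmult prob_space.emeasure_space_1[OF prob] distrib_left mult.assoc)
  qed
  finally show ?thesis .
qed

lemma total_cost_eq_suminf:
  assumes rep: "markov_representation \<mu> S' s0' \<zeta>' \<kappa> P"
    and \<zeta>[measurable]: "(\<lambda>(s, x). \<zeta> s x) \<in> S \<Otimes>\<^sub>M \<mu> \<rightarrow>\<^sub>M S" and s0: "s0 \<in> space S"
    and a[measurable]: "a \<in> borel_measurable S" and b: "b \<in> borel_measurable S"
  shows "total_cost a b s0 \<zeta> P =
    (\<Sum>n. \<integral>\<^sup>+\<omega>. survival b (statistic s0 \<zeta> \<omega>) n * a (statistic s0 \<zeta> \<omega> n) \<partial>P)"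
  unfolding total_cost_def
proof (rule nn_integral_suminf)
  fix n
  have sets_P: "sets P = sets (paths \<mu>)"
    using rep by (auto simp: markov_representation_def)
  note [measurable] = measurable_survival_past[OF \<zeta> s0 b, of n]
    measurable_statistic_past[OF \<zeta> s0 order.refl, of n]
  have "(\<lambda>\<omega>. survival b (statistic s0 \<zeta> \<omega>) n * a (statistic s0 \<zeta> \<omega> n)) \<in> borel_measurable (past \<mu> n)"
    by measurable
  from measurable_from_past[OF this]
  show "(\<lambda>\<omega>. survival b (statistic s0 \<zeta> \<omega>) n * a (statistic s0 \<zeta> \<omega> n)) \<in> borel_measurable P"
    by (simp add: measurable_cong_sets[OF sets_P refl])
qed

text \<open>
  Almost surely the conditional distribution is one of the candidates in the supremum. Hence the
  cost paid up to time \<open>n\<close> plus the expected surviving value \<open>v\<close> at time \<open>n\<close> is nonincreasing in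
  \<open>n\<close>; at time 0 it is \<open>v s0\<close>.
\<close>

lemma total_cost_le_solution:
  assumes rep: "markov_representation \<mu> S' s0' \<zeta>' \<kappa> P"
    and \<zeta>: "(\<lambda>(s, x). \<zeta> s x) \<in> S \<Otimes>\<^sub>M \<mu> \<rightarrow>\<^sub>M S" and s0: "s0 \<in> space S"
    and a: "a \<in> borel_measurable S" and b: "b \<in> borel_measurable S" and v: "v \<in> borel_measurable S"
    and sol: "\<And>s. s \<in> space S \<Longrightarrow> v s = bellman a b \<zeta> D v s"
    and adm: "\<And>n. AE \<omega> in P. \<kappa> (statistic s0' \<zeta>' \<omega> n) \<in> D (statistic s0 \<zeta> \<omega> n)"
  shows "total_cost a b s0 \<zeta> P \<le> v s0"
proof -
  from rep have sets_P: "sets P = sets (paths \<mu>)" and P: "prob_space P"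
    by (auto simp: markov_representation_def)
  interpret P: prob_space P by (rule P)
  let ?W = "\<lambda>n \<omega>. survival b (statistic s0 \<zeta> \<omega>) n" and ?s = "\<lambda>n \<omega>. statistic s0 \<zeta> \<omega> n"
  let ?A = "\<lambda>n. \<integral>\<^sup>+\<omega>. ?W n \<omega> * a (?s n \<omega>) \<partial>P" and ?V = "\<lambda>n. \<integral>\<^sup>+\<omega>. ?W n \<omega> * v (?s n \<omega>) \<partial>P"
  have step: "?A n + ?V (Suc n) \<le> ?V n" for n
    unfolding survival_weighted_step[OF rep \<zeta> s0 a b v]
  proof (rule nn_integral_mono_AE)
    show "AE \<omega> in P. ?W n \<omega> * (a (?s n \<omega>) + b (?s n \<omega>) *
        (\<integral>\<^sup>+x. v (\<zeta> (?s n \<omega>) x) \<partial>\<kappa> (statistic s0' \<zeta>' \<omega> n))) \<le> ?W n \<omega> * v (?s n \<omega>)"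
      using adm[of n] AE_space
    proof eventually_elim
      fix \<omega> assume adm\<omega>: "\<kappa> (statistic s0' \<zeta>' \<omega> n) \<in> D (?s n \<omega>)" and "\<omega> \<in> space P"
      then have "?s n \<omega> \<in> space S"
        using statistic_in_space[OF \<zeta> s0] sets_eq_imp_space_eq[OF sets_P] by auto
      then show "?W n \<omega> * (a (?s n \<omega>) + b (?s n \<omega>) *
          (\<integral>\<^sup>+x. v (\<zeta> (?s n \<omega>) x) \<partial>\<kappa> (statistic s0' \<zeta>' \<omega> n))) \<le> ?W n \<omega> * v (?s n \<omega>)"
        by (subst sol) (auto simp: bellman_def intro!: mult_left_mono add_left_mono SUP_upper2[OF adm\<omega>])
    qed
  qed
  have bound: "(\<Sum>i<n. ?A i) + ?V n \<le> v s0" for n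
  proof (induction n)
    case 0
    then show ?case by (simp add: survival_def P.emeasure_space_1)
  next
    case (Suc n)
    have "(\<Sum>i<Suc n. ?A i) + ?V (Suc n) = (\<Sum>i<n. ?A i) + (?A n + ?V (Suc n))"
      by (simp only: sum.lessThan_Suc add.assoc)
    also have "\<dots> \<le> (\<Sum>i<n. ?A i) + ?V n"
      by (intro add_left_mono step)
    finally show ?case
      using Suc by (rule order_trans)
  qed
  have "(\<Sum>i<n. ?A i) \<le> v s0" for n
    by (rule order_trans[OF _ bound[of n]]) simp
  then show ?thesis
    unfolding total_cost_eq_suminf[OF rep \<zeta> s0 a b] by (intro suminf_le_const) auto
qed

text \<open>
  By Knaster and Tarski, the monotone operator \<open>T\<close> has a greatest fixed point below any
  supersolution \<open>c * v\<close>, and it dominates all subsolutions below \<open>c * v\<close>. Uniqueness identifies it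
  with \<open>v\<close>. This is the form in which uniqueness is used, and it is essential that the competitors
  may exceed \<open>v\<close>, i.e. that \<open>c > 1\<close> is possible.
\<close>

lemma unique_solution_greatest:
  assumes uniq: "unique_solution S T v"
    and mono: "\<And>f g s. (\<And>s. s \<in> space S \<Longrightarrow> f s \<le> g s) \<Longrightarrow> s \<in> space S \<Longrightarrow> T f s \<le> T g s"
    and c: "c < \<infinity>" and upper: "\<And>s. s \<in> space S \<Longrightarrow> T (\<lambda>s. c * v s) s \<le> c * v s"
    and g_le: "\<And>s. s \<in> space S \<Longrightarrow> g s \<le> c * v s"
    and sub: "\<And>s. s \<in> space S \<Longrightarrow> g s \<le> T g s"
    and s: "s \<in> space S"
  shows "g s \<le> v s"
proof -
  \<comment> \<open>Cutting off at \<open>c * v\<close> and outside of the space makes the complete lattice of all functions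
    available; neither affects fixed points below \<open>c * v\<close>.\<close>
  define F where "F h s = (if s \<in> space S then inf (T h s) (c * v s) else 0)" for h s
  have "mono F"
  proof (rule monoI, rule le_funI)
    fix f h :: "'a \<Rightarrow> ennreal" and s assume "f \<le> h"
    then show "F f s \<le> F h s"
      using mono[of f h s] by (auto simp: F_def le_fun_def intro: le_infI1)
  qed
  then have G: "gfp F = F (gfp F)"
    by (rule gfp_unfold)
  have G_le: "gfp F s \<le> c * v s" if "s \<in> space S" for s
    by (subst G) (simp add: F_def that)
  have G_fix: "gfp F s = T (gfp F) s" if "s \<in> space S" for s
  proof -
    have "T (gfp F) s \<le> c * v s"
      using mono[of "gfp F" "\<lambda>s. c * v s" s] G_le upper[OF that] that by auto
    then show ?thesis
      by (subst G) (simp add: F_def that inf_absorb1)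
  qed
  have G_eq: "gfp F s = v s"
    using uniq s c G_le G_fix unfolding unique_solution_def by blast
  define h where "h s = (if s \<in> space S then g s else 0)" for s
  have "h \<le> F h"
  proof (rule le_funI)
    fix s
    show "h s \<le> F h s"
    proof (cases "s \<in> space S")
      case True
      have "T g s \<le> T h s"
        by (rule mono) (auto simp: h_def True)
      then show ?thesis
        using sub[OF True] g_le[OF True] True by (simp add: h_def F_def)
    qed (simp add: h_def F_def)
  qed
  then have "h \<le> gfp F"
    by (rule gfp_upperbound)
  then show ?thesis
    using s G_eq by (auto simp: h_def le_fun_def split: if_splits dest: spec[of _ s])
qed

text \<open>
  Divide by \<open>c\<close>; this fails for \<open>c = \<infinity>\<close>, where \<open>c * 0 = 0\<close>.
\<close>

lemma INF_mult_left_le_ennreal: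
  fixes c :: ennreal
  assumes c: "c \<noteq> 0" "c < \<infinity>"
  shows "(INF i\<in>I. c * f i) \<le> c * (INF i\<in>I. f i)"
proof -
  let ?m = "INF i\<in>I. c * f i"
  have "?m / c \<le> (INF i\<in>I. f i)"
  proof (rule INF_greatest)
    fix i assume "i \<in> I"
    then have "?m \<le> f i * c"
      by (subst mult.commute) (rule INF_lower)
    then show "?m / c \<le> f i"
      using c by (intro divide_le_posI_ennreal) (auto simp: zero_less_iff_neq_zero mult.commute)
  qed
  then have "c * (?m / c) \<le> c * (INF i\<in>I. f i)"
    by (rule mult_left_mono) simp
  moreover have "c * (?m / c) = ?m"
    using c by (simp add: ennreal_times_divide mult.commute[of c] ennreal_mult_divide_eq)
  ultimately show ?thesis by simp
qed

text \<open>
  Its iterates applied to \<open>v\<close> are the expected surviving value after \<open>n\<close> steps, that is, what is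
  left unpaid of \<open>v\<close> when the policy \<open>\<kappa>\<close> is followed.
\<close>

definition policy_op ::
  "('s \<Rightarrow> ennreal) \<Rightarrow> ('s \<Rightarrow> 'x \<Rightarrow> 's) \<Rightarrow> ('s \<Rightarrow> 'x measure) \<Rightarrow> ('s \<Rightarrow> ennreal) \<Rightarrow> 's \<Rightarrow> ennreal" where
  "policy_op b \<zeta> \<kappa> f s = b s * (\<integral>\<^sup>+x. f (\<zeta> s x) \<partial>\<kappa> s)"

lemma measurable_policy_op_iterate:
  assumes \<zeta>[measurable]: "(\<lambda>(s, x). \<zeta> s x) \<in> S \<Otimes>\<^sub>M \<mu> \<rightarrow>\<^sub>M S" and \<kappa>: "\<kappa> \<in> S \<rightarrow>\<^sub>M prob_algebra \<mu>"
    and b[measurable]: "b \<in> borel_measurable S" and v: "v \<in> borel_measurable S"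
  shows "(policy_op b \<zeta> \<kappa> ^^ n) v \<in> borel_measurable S"
proof (induction n)
  case 0
  then show ?case using v by simp
next
  case (Suc n)
  note [measurable] = Suc
  have [measurable]: "(\<lambda>s. \<integral>\<^sup>+x. (policy_op b \<zeta> \<kappa> ^^ n) v (\<zeta> s x) \<partial>\<kappa> s) \<in> borel_measurable S"
    by (rule nn_integral_measurable_subprob_algebra2[OF _ measurable_prob_algebraD[OF \<kappa>]]) measurable
  have "(policy_op b \<zeta> \<kappa> ^^ Suc n) v = (\<lambda>s. b s * (\<integral>\<^sup>+x. (policy_op b \<zeta> \<kappa> ^^ n) v (\<zeta> s x) \<partial>\<kappa> s))"
    by (rule ext) (simp only: funpow.simps o_apply policy_op_def[of b \<zeta> \<kappa> "(policy_op b \<zeta> \<kappa> ^^ n) v"])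
  then show ?case
    by simp
qed

lemma survival_weighted_integral:
  assumes rep: "markov_representation \<mu> S s0 \<zeta> \<kappa> P"
    and b[measurable]: "b \<in> borel_measurable S" and v: "v \<in> borel_measurable S"
  shows "(\<integral>\<^sup>+\<omega>. survival b (statistic s0 \<zeta> \<omega>) n * v (statistic s0 \<zeta> \<omega> n) \<partial>P) =
    (policy_op b \<zeta> \<kappa> ^^ n) v s0"
proof -
  from rep have \<zeta>[measurable]: "(\<lambda>(s, x). \<zeta> s x) \<in> S \<Otimes>\<^sub>M \<mu> \<rightarrow>\<^sub>M S"
    and \<kappa>: "\<kappa> \<in> S \<rightarrow>\<^sub>M prob_algebra \<mu>"
    by (auto simp: markov_representation_def)
  note meas = measurable_policy_op_iterate[OF \<zeta> \<kappa> b v]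
  have "(\<integral>\<^sup>+\<omega>. (\<Prod>i<n. b (statistic s0 \<zeta> \<omega> i)) *
      (policy_op b \<zeta> \<kappa> ^^ (n - n)) v (statistic s0 \<zeta> \<omega> n) \<partial>P) = (policy_op b \<zeta> \<kappa> ^^ (n - 0)) v s0"
  proof (rule backward_iteration[OF rep, where a="\<lambda>_ s _. b s"])
    fix m s assume m: "m < n" and s: "s \<in> space S"
    note [measurable] = meas[of "n - Suc m"]
    have sets: "sets (\<kappa> s) = sets \<mu>"
      using measurable_space[OF \<kappa> s] by (simp add: space_prob_algebra)
    have "(\<lambda>x. (policy_op b \<zeta> \<kappa> ^^ (n - Suc m)) v (\<zeta> s x)) \<in> borel_measurable \<mu>"
      using s by measurable
    then have "(\<integral>\<^sup>+x. b s * (policy_op b \<zeta> \<kappa> ^^ (n - Suc m)) v (\<zeta> s x) \<partial>\<kappa> s) =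
        policy_op b \<zeta> \<kappa> ((policy_op b \<zeta> \<kappa> ^^ (n - Suc m)) v) s"
      unfolding policy_op_def[of _ _ _ _ s]
      by (intro nn_integral_cmult) (simp add: measurable_cong_sets[OF sets refl])
    also have "\<dots> = (policy_op b \<zeta> \<kappa> ^^ (n - m)) v s"
      using Suc_diff_Suc[OF m, symmetric] by simp
    finally show "(policy_op b \<zeta> \<kappa> ^^ (n - m)) v s =
        (\<integral>\<^sup>+x. b s * (policy_op b \<zeta> \<kappa> ^^ (n - Suc m)) v (\<zeta> s x) \<partial>\<kappa> s)" ..
  qed (auto intro: meas)
  then show ?thesis
    by (simp add: survival_def)
qed

definition attains :: "('s \<Rightarrow> 'x \<Rightarrow> 's) \<Rightarrow> ('s \<Rightarrow> 'x measure set) \<Rightarrow> ('s \<Rightarrow> ennreal) \<Rightarrow> 's \<Rightarrow> 'x measure \<Rightarrow> bool" where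
  "attains \<zeta> D v s H \<longleftrightarrow>
     H \<in> D s \<and> (\<integral>\<^sup>+x. v (\<zeta> s x) \<partial>H) = (SUP H'\<in>D s. \<integral>\<^sup>+x. v (\<zeta> s x) \<partial>H')"

text \<open>
  Attaining the suprema in the Bellman equation does not by itself make a policy optimal: it could
  postpone the cost forever while the value \<open>v\<close> is carried along. The limit \<open>r\<close> of the
  continuation values measures exactly this postponed part. Where \<open>v\<close> is finite and the suprema are
  attained from now on, \<open>r s \<le> b s * (\<integral>\<^sup>+x. r (\<zeta> s x) \<partial>\<kappa> s)\<close> by monotone convergence. Adding this
  to the Bellman equation shows that \<open>v + r\<close> is a subsolution, and it is bounded by \<open>2 * v\<close>. By
  \<open>unique_solution_greatest\<close> it cannot exceed \<open>v\<close>, so \<open>r\<close> vanishes where \<open>v\<close> is finite.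
  
  The policy attains the suprema only almost surely along the path, and the set of states where it
  does need not be measurable. Therefore \<open>r\<close> is added only in those states from which almost every
  path stays in this set. By \<open>AE_path_law_step\<close> such a state is left, almost surely, to another
  such state, and integrals do not see the difference between \<open>r\<close> and its restriction.
\<close>

lemma continuation_vanishes:
  assumes rep: "markov_representation \<mu> S s0 \<zeta> \<kappa> P"
    and uniq: "unique_solution S (bellman a b \<zeta> D) v"
    and b[measurable]: "b \<in> borel_measurable S" and b_fin: "\<And>s. s \<in> space S \<Longrightarrow> b s < \<infinity>"
    and D: "\<And>s H. s \<in> space S \<Longrightarrow> H \<in> D s \<Longrightarrow> sets H = sets \<mu>"
    and max: "\<And>n. AE \<omega> in P. attains \<zeta> D v (statistic s0 \<zeta> \<omega> n) (\<kappa> (statistic s0 \<zeta> \<omega> n))"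
    and fin: "v s0 < \<infinity>"
  shows "(INF n. (policy_op b \<zeta> \<kappa> ^^ n) v s0) = 0"
proof -
  from rep have s0: "s0 \<in> space S" and \<zeta>[measurable]: "(\<lambda>(s, x). \<zeta> s x) \<in> S \<Otimes>\<^sub>M \<mu> \<rightarrow>\<^sub>M S"
    and \<kappa>: "\<kappa> \<in> S \<rightarrow>\<^sub>M prob_algebra \<mu>"
    by (auto simp: markov_representation_def)
  from uniq have v: "v \<in> borel_measurable S"
    and sol: "\<And>s. s \<in> space S \<Longrightarrow> v s = bellman a b \<zeta> D v s"
    unfolding unique_solution_def by blast+
  let ?L = "path_law \<mu> S \<zeta> \<kappa>"
  define r where "r n = (policy_op b \<zeta> \<kappa> ^^ n) v" for n
  define r_lim where "r_lim s = (INF n. r n s)" for s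
  have r_Suc: "r (Suc n) s = b s * (\<integral>\<^sup>+x. r n (\<zeta> s x) \<partial>\<kappa> s)" for n s
    by (simp add: r_def policy_op_def)
  have r_meas[measurable]: "r n \<in> borel_measurable S" for n
    unfolding r_def by (rule measurable_policy_op_iterate[OF \<zeta> \<kappa> b v])
  have r_inf_meas[measurable]: "r_lim \<in> borel_measurable S"
    unfolding r_lim_def[abs_def] by measurable
  define good where "good = {s \<in> space S. AE \<omega> in ?L s. \<forall>n.
    attains \<zeta> D v (statistic s \<zeta> \<omega> n) (\<kappa> (statistic s \<zeta> \<omega> n))}"
  have s0_good: "s0 \<in> good"
    using max s0 unfolding good_def path_law_unique[OF rep] by (simp add: AE_all_countable)
  have good_space: "s \<in> space S" if "s \<in> good" for s
    using that by (simp add: good_def)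
  have good_attains: "attains \<zeta> D v s (\<kappa> s)" if "s \<in> good" for s
  proof -
    have "AE \<omega> in ?L s. \<forall>n. attains \<zeta> D v (statistic s \<zeta> \<omega> n) (\<kappa> (statistic s \<zeta> \<omega> n))"
      using that by (simp add: good_def)
    then have "AE \<omega> in ?L s. attains \<zeta> D v s (\<kappa> s)"
      by (rule eventually_mono) (drule spec[of _ 0], simp)
    moreover have "prob_space (?L s)"
      using markov_representation_path_law[OF \<zeta> \<kappa> good_space[OF that]]
      by (simp add: markov_representation_def)
    ultimately show ?thesis
      using prob_space.AE_False by (cases "attains \<zeta> D v s (\<kappa> s)") auto
  qed
  have good_step: "AE x in \<kappa> s. \<zeta> s x \<in> good" if s: "s \<in> good" for s
  proof -
    have "AE x in \<kappa> s. AE \<omega> in ?L (\<zeta> s x). \<forall>n. attains \<zeta> D v (statistic s \<zeta> (case_nat x \<omega>) n)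
        (\<kappa> (statistic s \<zeta> (case_nat x \<omega>) n))"
      using s by (intro AE_path_law_step[OF \<zeta> \<kappa>]) (auto simp: good_def)
    moreover have "AE x in \<kappa> s. \<zeta> s x \<in> space S"
    proof (rule AE_I2)
      fix x assume "x \<in> space (\<kappa> s)"
      then have "x \<in> space \<mu>"
        using measurable_space[OF \<kappa> good_space[OF s]]
        by (auto simp: space_prob_algebra dest: sets_eq_imp_space_eq)
      then show "\<zeta> s x \<in> space S"
        using measurable_space[OF \<zeta>, of "(s, x)"] good_space[OF s] by (simp add: space_pair_measure)
    qed
    ultimately show ?thesis
    proof eventually_elim
      fix x assume "AE \<omega> in ?L (\<zeta> s x). \<forall>n. attains \<zeta> D v (statistic s \<zeta> (case_nat x \<omega>) n)
          (\<kappa> (statistic s \<zeta> (case_nat x \<omega>) n))" and "\<zeta> s x \<in> space S"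
      then show "\<zeta> s x \<in> good"
        unfolding good_def mem_Collect_eq statistic_case_nat[symmetric]
        by (intro conjI) (auto elim: eventually_mono simp del: statistic.simps)
    qed
  qed
  have attained: "v s = a s + b s * (\<integral>\<^sup>+x. v (\<zeta> s x) \<partial>\<kappa> s)" if "s \<in> good" for s
    using sol[OF good_space[OF that]] good_attains[OF that] by (simp add: attains_def bellman_def)
  have r_decreasing: "r (Suc n) s \<le> r n s" if "s \<in> good" for n s
    using that
  proof (induction n arbitrary: s)
    case 0
    then show ?case
      using attained[OF 0] by (simp add: r_def policy_op_def)
  next
    case (Suc n)
    have "AE x in \<kappa> s. r (Suc n) (\<zeta> s x) \<le> r n (\<zeta> s x)"
      using good_step[OF Suc.prems] by (rule AE_mp) (auto intro: Suc.IH)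
    then show ?case
      unfolding r_Suc[of "Suc n"] r_Suc[of n] by (intro mult_left_mono nn_integral_mono_AE) auto
  qed
  have r_inf_step: "r_lim s \<le> b s * (\<integral>\<^sup>+x. r_lim (\<zeta> s x) \<partial>\<kappa> s)" if s: "s \<in> good" and fin: "v s < \<infinity>" for s
  proof (cases "b s = 0")
    case True
    have "r_lim s \<le> r 1 s"
      unfolding r_lim_def by (rule INF_lower) simp
    also have "r 1 s = 0"
      using r_Suc[of 0 s] True by simp
    finally show ?thesis by simp
  next
    case False
    have sets: "sets (\<kappa> s) = sets \<mu>"
      using measurable_space[OF \<kappa> good_space[OF s]] by (simp add: space_prob_algebra)
    have "(\<integral>\<^sup>+x. r_lim (\<zeta> s x) \<partial>\<kappa> s) = (INF n. \<integral>\<^sup>+x. r n (\<zeta> s x) \<partial>\<kappa> s)"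
      unfolding r_lim_def
    proof (rule nn_integral_monotone_convergence_INF_AE)
      show "AE x in \<kappa> s. r (Suc n) (\<zeta> s x) \<le> r n (\<zeta> s x)" for n
        using good_step[OF s] by (rule AE_mp) (auto intro: r_decreasing)
      have "(\<lambda>x. r n (\<zeta> s x)) \<in> borel_measurable \<mu>" for n
        using good_space[OF s] by measurable
      then show "(\<lambda>x. r n (\<zeta> s x)) \<in> borel_measurable (\<kappa> s)" for n
        by (simp add: measurable_cong_sets[OF sets refl])
      have "b s * (\<integral>\<^sup>+x. v (\<zeta> s x) \<partial>\<kappa> s) < \<infinity>"
        using attained[OF s] fin by (metis add.commute ennreal_add_eq_top infinity_ennreal_def less_top)
      then show "(\<integral>\<^sup>+x. r 0 (\<zeta> s x) \<partial>\<kappa> s) < \<infinity>"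
        using False by (auto simp: r_def ennreal_mult_less_top ennreal_mult_eq_top_iff less_top)
    qed
    then have "(INF n. r (Suc n) s) \<le> b s * (\<integral>\<^sup>+x. r_lim (\<zeta> s x) \<partial>\<kappa> s)"
      using INF_mult_left_le_ennreal[OF False b_fin[OF good_space[OF s]]] by (simp add: r_Suc)
    moreover have "r_lim s \<le> (INF n. r (Suc n) s)"
      unfolding r_lim_def by (intro INF_greatest INF_lower) simp
    ultimately show ?thesis by (rule order_trans[rotated])
  qed
  define g where "g s = v s + (if s \<in> good then r_lim s else 0)" for s
  have "g s0 \<le> v s0"
  proof (rule unique_solution_greatest[OF uniq, where c=2])
    show mono: "bellman a b \<zeta> D f s \<le> bellman a b \<zeta> D h s"
      if le: "\<And>s. s \<in> space S \<Longrightarrow> f s \<le> h s" and s: "s \<in> space S" for f h s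
      unfolding bellman_def
    proof (intro add_left_mono mult_left_mono SUP_mono, rule bexI)
      fix H assume H: "H \<in> D s"
      have "\<zeta> s x \<in> space S" if "x \<in> space H" for x
        using that measurable_space[OF \<zeta>, of "(s, x)"] s sets_eq_imp_space_eq[OF D[OF s H]]
        by (simp add: space_pair_measure)
      then show "(\<integral>\<^sup>+x. f (\<zeta> s x) \<partial>H) \<le> (\<integral>\<^sup>+x. h (\<zeta> s x) \<partial>H)"
        by (intro nn_integral_mono le) auto
    qed auto
    show "bellman a b \<zeta> D (\<lambda>s. 2 * v s) s \<le> 2 * v s" if s: "s \<in> space S" for s
    proof -
      have "(\<integral>\<^sup>+x. 2 * v (\<zeta> s x) \<partial>H) = 2 * (\<integral>\<^sup>+x. v (\<zeta> s x) \<partial>H)" if "H \<in> D s" for H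
      proof (rule nn_integral_cmult)
        have "(\<lambda>x. v (\<zeta> s x)) \<in> borel_measurable \<mu>"
          using s v by measurable
        then show "(\<lambda>x. v (\<zeta> s x)) \<in> borel_measurable H"
          by (simp add: measurable_cong_sets[OF D[OF s that] refl])
      qed
      then have "bellman a b \<zeta> D (\<lambda>s. 2 * v s) s = a s + 2 * (b s * (SUP H\<in>D s. \<integral>\<^sup>+x. v (\<zeta> s x) \<partial>H))"
        by (simp add: bellman_def SUP_mult_left_ennreal[symmetric] mult.left_commute)
      also have "\<dots> \<le> 2 * a s + 2 * (b s * (SUP H\<in>D s. \<integral>\<^sup>+x. v (\<zeta> s x) \<partial>H))"
        by (intro add_right_mono) (simp add: mult_2)
      also have "\<dots> = 2 * v s"
        using sol[OF s] by (simp add: bellman_def distrib_left)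
      finally show ?thesis .
    qed
    show "g s \<le> 2 * v s" for s
    proof -
      have "r_lim s \<le> r 0 s"
        unfolding r_lim_def by (rule INF_lower) simp
      then show ?thesis
        by (auto simp: g_def r_def mult_2 intro!: add_left_mono)
    qed
    show "g s \<le> bellman a b \<zeta> D g s" if s: "s \<in> space S" for s
    \<comment> \<open>Where \<open>v\<close> is infinite, so is the right hand side, and adding \<open>r\<close> changes nothing.\<close>
    proof (cases "s \<in> good \<and> v s < \<infinity>")
      case False
      have "v s \<le> bellman a b \<zeta> D g s"
        by (subst sol[OF s]) (rule mono, auto simp: g_def s)
      moreover have "g s = v s"
        using False by (auto simp: g_def less_top[symmetric])
      ultimately show ?thesis by simp
    next
      case True
      then have good: "s \<in> good" and fin: "v s < \<infinity>" by auto
      have sets: "sets (\<kappa> s) = sets \<mu>"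
        using measurable_space[OF \<kappa> s] by (simp add: space_prob_algebra)
      have meas: "(\<lambda>x. v (\<zeta> s x)) \<in> borel_measurable (\<kappa> s)" "(\<lambda>x. r_lim (\<zeta> s x)) \<in> borel_measurable (\<kappa> s)"
        unfolding measurable_cong_sets[OF sets refl] using s v by measurable
      have "g s = a s + b s * (\<integral>\<^sup>+x. v (\<zeta> s x) \<partial>\<kappa> s) + r_lim s"
        using good attained[OF good] by (simp add: g_def)
      also have "\<dots> \<le> a s + b s * (\<integral>\<^sup>+x. v (\<zeta> s x) \<partial>\<kappa> s) + b s * (\<integral>\<^sup>+x. r_lim (\<zeta> s x) \<partial>\<kappa> s)"
        by (intro add_left_mono r_inf_step good fin)
      also have "\<dots> = a s + b s * (\<integral>\<^sup>+x. v (\<zeta> s x) + r_lim (\<zeta> s x) \<partial>\<kappa> s)"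
        by (simp add: nn_integral_add meas distrib_left add.assoc)
      \<comment> \<open>\<open>g\<close> itself need not be measurable, but it agrees almost everywhere with \<open>v + r\<close>.\<close>
      also have "(\<integral>\<^sup>+x. v (\<zeta> s x) + r_lim (\<zeta> s x) \<partial>\<kappa> s) = (\<integral>\<^sup>+x. g (\<zeta> s x) \<partial>\<kappa> s)"
        using good_step[OF good] by (intro nn_integral_cong_AE) (auto simp: g_def elim!: AE_mp)
      also have "a s + b s * \<dots> \<le> bellman a b \<zeta> D g s"
        using good_attains[OF good] unfolding bellman_def attains_def
        by (intro add_left_mono mult_left_mono SUP_upper) auto
      finally show ?thesis .
    qed
  qed (use s0 in auto)
  then have "v s0 + r_lim s0 \<le> v s0 + 0"
    using s0_good by (simp add: g_def)
  then have "r_lim s0 \<le> 0"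
    using fin by (subst (asm) ennreal_add_left_cancel_le) auto
  then show ?thesis
    by (simp add: r_lim_def r_def)
qed

text \<open>
  For a policy that attains the suprema, the inequality in \<open>total_cost_le_solution\<close> is an equality
  in each step, so \<open>v s0\<close> is the cost paid up to time \<open>n\<close> plus the continuation value. The latter
  becomes arbitrarily small.
\<close>

lemma solution_le_total_cost:
  assumes rep: "markov_representation \<mu> S s0 \<zeta> \<kappa> P"
    and uniq: "unique_solution S (bellman a b \<zeta> D) v"
    and a: "a \<in> borel_measurable S"
    and b: "b \<in> borel_measurable S" and b_fin: "\<And>s. s \<in> space S \<Longrightarrow> b s < \<infinity>"
    and D: "\<And>s H. s \<in> space S \<Longrightarrow> H \<in> D s \<Longrightarrow> sets H = sets \<mu>"
    and max: "\<And>n. AE \<omega> in P. attains \<zeta> D v (statistic s0 \<zeta> \<omega> n) (\<kappa> (statistic s0 \<zeta> \<omega> n))"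
    and fin: "v s0 < \<infinity>"
  shows "v s0 \<le> total_cost a b s0 \<zeta> P"
proof -
  from rep have s0: "s0 \<in> space S" and \<zeta>: "(\<lambda>(s, x). \<zeta> s x) \<in> S \<Otimes>\<^sub>M \<mu> \<rightarrow>\<^sub>M S"
    and sets_P: "sets P = sets (paths \<mu>)" and P: "prob_space P"
    by (auto simp: markov_representation_def)
  interpret P: prob_space P by (rule P)
  from uniq have v: "v \<in> borel_measurable S"
    and sol: "\<And>s. s \<in> space S \<Longrightarrow> v s = bellman a b \<zeta> D v s"
    unfolding unique_solution_def by blast+
  let ?W = "\<lambda>n \<omega>. survival b (statistic s0 \<zeta> \<omega>) n" and ?s = "\<lambda>n \<omega>. statistic s0 \<zeta> \<omega> n"
  let ?A = "\<lambda>n. \<integral>\<^sup>+\<omega>. ?W n \<omega> * a (?s n \<omega>) \<partial>P" and ?V = "\<lambda>n. \<integral>\<^sup>+\<omega>. ?W n \<omega> * v (?s n \<omega>) \<partial>P"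
  have step: "?A n + ?V (Suc n) = ?V n" for n
    unfolding survival_weighted_step[OF rep \<zeta> s0 a b v]
  proof (rule nn_integral_cong_AE)
    show "AE \<omega> in P. ?W n \<omega> * (a (?s n \<omega>) + b (?s n \<omega>) *
        (\<integral>\<^sup>+x. v (\<zeta> (?s n \<omega>) x) \<partial>\<kappa> (?s n \<omega>))) = ?W n \<omega> * v (?s n \<omega>)"
      using max[of n] AE_space
    proof eventually_elim
      fix \<omega> assume *: "attains \<zeta> D v (?s n \<omega>) (\<kappa> (?s n \<omega>))" and "\<omega> \<in> space P"
      then have "?s n \<omega> \<in> space S"
        using statistic_in_space[OF \<zeta> s0] sets_eq_imp_space_eq[OF sets_P] by auto
      from sol[OF this] *
      show "?W n \<omega> * (a (?s n \<omega>) + b (?s n \<omega>) *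
        (\<integral>\<^sup>+x. v (\<zeta> (?s n \<omega>) x) \<partial>\<kappa> (?s n \<omega>))) = ?W n \<omega> * v (?s n \<omega>)"
        by (simp add: attains_def bellman_def)
    qed
  qed
  have telescope: "(\<Sum>i<n. ?A i) + ?V n = v s0" for n
  proof (induction n)
    case 0
    then show ?case by (simp add: survival_def P.emeasure_space_1)
  next
    case (Suc n)
    have "(\<Sum>i<Suc n. ?A i) + ?V (Suc n) = (\<Sum>i<n. ?A i) + (?A n + ?V (Suc n))"
      by (simp only: sum.lessThan_Suc add.assoc)
    then show ?case using Suc by (simp only: step)
  qed
  have "v s0 \<le> total_cost a b s0 \<zeta> P + ?V n" for n
    unfolding total_cost_eq_suminf[OF rep \<zeta> s0 a b] telescope[of n, symmetric]
    by (intro add_right_mono sum_le_suminf) auto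
  then have "v s0 \<le> (INF n. total_cost a b s0 \<zeta> P + ?V n)"
    by (intro INF_greatest)
  also have "\<dots> = total_cost a b s0 \<zeta> P + (INF n. ?V n)"
    by (rule INF_ennreal_const_add)
  also have "(INF n. ?V n) = 0"
    using continuation_vanishes[OF rep uniq b b_fin D max fin]
    by (simp add: survival_weighted_integral[OF rep b v])
  finally show ?thesis by simp
qed

lemma attains_iff_is_arg_max:
  "attains \<zeta> D v s H \<longleftrightarrow> is_arg_max (\<lambda>H. \<integral>\<^sup>+x. v (\<zeta> s x) \<partial>H) (\<lambda>H. H \<in> D s) H"
proof
  assume "attains \<zeta> D v s H"
  then show "is_arg_max (\<lambda>H. \<integral>\<^sup>+x. v (\<zeta> s x) \<partial>H) (\<lambda>H. H \<in> D s) H"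
    unfolding attains_def is_arg_max_def by (metis SUP_upper leD)
next
  assume H: "is_arg_max (\<lambda>H. \<integral>\<^sup>+x. v (\<zeta> s x) \<partial>H) (\<lambda>H. H \<in> D s) H"
  then have "(\<integral>\<^sup>+x. v (\<zeta> s x) \<partial>H') \<le> (\<integral>\<^sup>+x. v (\<zeta> s x) \<partial>H)" if "H' \<in> D s" for H'
    using that by (auto simp: is_arg_max_def not_less[symmetric])
  with H show "attains \<zeta> D v s H"
    unfolding attains_def by (auto simp: is_arg_max_def intro!: antisym SUP_least SUP_upper)
qed

section \<open>Recording the history as statistic\<close>

text \<open>
  Any statistic is a function of the list of past observations, namely a left fold of its update.
  Taking the list itself as statistic, with the sigma-algebra pulled back along the fold, makes
  appending measurable and moves the representation to lists.
\<close>

lemma markov_constrained_history: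
  fixes \<mu> :: "'x measure"
  assumes "markov_constrained \<mu> S s0 \<zeta> C P"
  shows "\<exists>(S' :: 'x list measure) s0' \<zeta>'. markov_constrained \<mu> S' s0' \<zeta>' C P"
proof -
  obtain \<kappa> where rep: "markov_representation \<mu> S s0 \<zeta> \<kappa> P"
    and C: "\<And>n. AE \<omega> in P. \<kappa> (statistic s0 \<zeta> \<omega> n) \<in> C n \<omega>"
    using assms by (auto simp: markov_constrained_def)
  from rep have s0: "s0 \<in> space S" and \<zeta>[measurable]: "(\<lambda>(s, x). \<zeta> s x) \<in> S \<Otimes>\<^sub>M \<mu> \<rightarrow>\<^sub>M S"
    and \<kappa>: "\<kappa> \<in> S \<rightarrow>\<^sub>M prob_algebra \<mu>"
    by (auto simp: markov_representation_def)
  \<comment> \<open>Decodes a history into the value of the given statistic.\<close>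
  define d where "d = foldl \<zeta> s0"
  define S' where "S' = vimage_algebra (lists (space \<mu>)) d S"
  define app where "app xs x = xs @ [x]" for xs and x :: 'x
  have \<zeta>_space: "\<zeta> s x \<in> space S" if "s \<in> space S" "x \<in> space \<mu>" for s x
    using measurable_space[OF \<zeta>, of "(s, x)"] that by (simp add: space_pair_measure)
  have d_app: "d (app xs x) = \<zeta> (d xs) x" for xs x
    by (simp add: d_def app_def)
  have d_space: "d xs \<in> space S" if "xs \<in> lists (space \<mu>)" for xs
    using that
  proof (induction xs rule: rev_induct)
    case Nil
    then show ?case using s0 by (simp add: d_def)
  next
    case (snoc x xs)
    then show ?case using \<zeta>_space d_app[of xs x] by (simp add: app_def)
  qed
  have d: "d \<in> S' \<rightarrow>\<^sub>M S"
    unfolding S'_def by (rule measurable_vimage_algebra1) (auto intro: d_space)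
  have hist: "d (statistic [] app \<omega> n) = statistic s0 \<zeta> \<omega> n" for \<omega> n
    by (induction n) (simp_all add: d_app, simp add: d_def)
  have app: "(\<lambda>(xs, x). app xs x) \<in> S' \<Otimes>\<^sub>M \<mu> \<rightarrow>\<^sub>M S'"
    unfolding S'_def
  proof (rule measurable_vimage_algebra2, fold S'_def)
    show "(\<lambda>(xs, x). app xs x) \<in> space (S' \<Otimes>\<^sub>M \<mu>) \<rightarrow> lists (space \<mu>)"
      by (auto simp: space_pair_measure S'_def app_def)
    note [measurable] = d
    have "(\<lambda>p. \<zeta> (d (fst p)) (snd p)) \<in> S' \<Otimes>\<^sub>M \<mu> \<rightarrow>\<^sub>M S"
      by measurable
    then show "(\<lambda>p. d (case p of (xs, x) \<Rightarrow> app xs x)) \<in> S' \<Otimes>\<^sub>M \<mu> \<rightarrow>\<^sub>M S"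
      by (simp add: split_beta' d_app)
  qed
  have "markov_representation \<mu> S' [] app (\<lambda>xs. \<kappa> (d xs)) P"
    using rep app measurable_compose[OF d \<kappa>]
    by (simp add: markov_representation_def hist S'_def)
  then show ?thesis
    using C by (auto simp: markov_constrained_def hist intro!: exI[of _ S'] exI[of _ "[]"] exI[of _ app])
qed

section \<open>Tests as total cost problems\<close>

lemma nn_integral_count_space_enat:
  "(\<integral>\<^sup>+t. f t \<partial>count_space (UNIV :: enat set)) = (\<Sum>n. f (enat n)) + f \<infinity>"
proof -
  have "f t = f t * indicator (range enat) t + f \<infinity> * indicator {\<infinity>} t" for t
    by (cases t) (auto simp: indicator_def)
  then have "(\<integral>\<^sup>+t. f t \<partial>count_space UNIV) =
      (\<integral>\<^sup>+t. f t * indicator (range enat) t + f \<infinity> * indicator {\<infinity>} t \<partial>count_space UNIV)"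
    by (intro nn_integral_cong)
  also have "\<dots> =
      (\<integral>\<^sup>+t. f t * indicator (range enat) t \<partial>count_space UNIV) +
      (\<integral>\<^sup>+t. f \<infinity> * indicator {\<infinity>} t \<partial>count_space UNIV)"
    by (subst nn_integral_add) auto
  also have "(\<integral>\<^sup>+t. f t * indicator (range enat) t \<partial>count_space UNIV) =
      (\<integral>\<^sup>+t. f t \<partial>count_space (range enat))"
    by (simp add: nn_integral_count_space_indicator)
  also have "\<dots> = (\<integral>\<^sup>+n. f (enat n) \<partial>count_space UNIV)"
    by (intro nn_integral_bij_count_space[symmetric]) (auto simp: bij_betw_def inj_on_def)
  also have "\<dots> = (\<Sum>n. f (enat n))"
    by (rule nn_integral_count_space_nat)
  also have "(\<integral>\<^sup>+t. f \<infinity> * indicator {\<infinity>} t \<partial>count_space UNIV) = f \<infinity>"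
    by (subst nn_integral_cmult_indicator) auto
  finally show ?thesis .
qed

lemma ennreal_of_enat_eq_suminf: "ennreal_of_enat t = (\<Sum>j. indicator {enat j<..} t)"
proof (cases t)
  case (enat n)
  have "(\<Sum>j. indicator {enat j<..} t :: ennreal) = (\<Sum>j<n. indicator {enat j<..} t)"
    by (rule suminf_finite) (auto simp: enat)
  also have "\<dots> = of_nat n"
    by (simp add: enat)
  finally show ?thesis by (simp add: enat)
next
  case infinity
  have "(\<Sum>j. 1 :: ennreal) = \<infinity>"
    by (simp add: nn_integral_count_space_nat[symmetric])
  then show ?thesis by (simp add: infinity)
qed

lemma sets_distributions_with_density: "H \<in> distributions_with_density \<mu> \<Longrightarrow> sets H = sets \<mu>"
  by (auto simp: distributions_with_density_def)

lemma snd_state: "snd (state \<pi> \<omega> n) = statistic (init \<pi>) (upd \<pi>) \<omega> n"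
  by (induction n) (auto simp: state_def init_state_def next_state_def split_beta)

definition continue_prob :: "('x, 't) policy \<Rightarrow> (nat \<Rightarrow> real) \<times> 't \<Rightarrow> ennreal" where
  "continue_prob \<pi> s = ennreal (1 - stop \<pi> s)"

lemma sum_stop_prob: "(\<Sum>n<m. stop_prob \<pi> \<omega> n) = 1 - (\<Prod>i<m. 1 - stop \<pi> (state \<pi> \<omega> i))"
  by (induction m) (simp_all add: stop_prob_def algebra_simps)

context
  fixes \<mu> :: "'x measure" and \<Theta> :: "'t measure" and \<pi> :: "('x, 't) policy"
  assumes policy: "testing_policy \<mu> \<Theta> \<pi>"
begin

lemma init_state_in_space: "init_state \<pi> \<in> space (state_space \<Theta> \<pi>)"
  using policy
  by (auto simp: testing_policy_def init_state_def state_space_def likelihood_space_def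
      space_pair_measure space_PiM space_restrict_space)

lemma measurable_next_state:
  "(\<lambda>(s, x). next_state \<pi> s x) \<in> state_space \<Theta> \<pi> \<Otimes>\<^sub>M \<mu> \<rightarrow>\<^sub>M state_space \<Theta> \<pi>"
proof -
  let ?K = "last_hyp \<pi>" and ?M = "state_space \<Theta> \<pi> \<Otimes>\<^sub>M \<mu>"
  have upd[measurable]: "(\<lambda>(\<theta>, x). upd \<pi> \<theta> x) \<in> \<Theta> \<Otimes>\<^sub>M \<mu> \<rightarrow>\<^sub>M \<Theta>"
    and dens: "\<And>k. k \<le> ?K \<Longrightarrow> (\<lambda>(\<theta>, x). dens \<pi> \<theta> k x) \<in> borel_measurable (\<Theta> \<Otimes>\<^sub>M \<mu>)"
    and nonneg: "\<And>k \<theta> x. k \<le> ?K \<Longrightarrow> \<theta> \<in> space \<Theta> \<Longrightarrow> x \<in> space \<mu> \<Longrightarrow> 0 \<le> dens \<pi> \<theta> k x"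
    using policy by (auto simp: testing_policy_def)
  have fst_meas[measurable]: "(\<lambda>p. fst (fst p)) \<in> ?M \<rightarrow>\<^sub>M likelihood_space ?K"
    and snd_meas[measurable]: "(\<lambda>p. snd (fst p)) \<in> ?M \<rightarrow>\<^sub>M \<Theta>" and [measurable]: "snd \<in> ?M \<rightarrow>\<^sub>M \<mu>"
    unfolding state_space_def by measurable
  have comp: "(\<lambda>p. fst (fst p) k * dens \<pi> (snd (fst p)) k (snd p)) \<in> ?M \<rightarrow>\<^sub>M restrict_space borel {0..}"
    if k: "k \<in> {..?K}" for k
  proof (rule measurable_restrict_space2)
    have "(\<lambda>z. z k) \<in> likelihood_space ?K \<rightarrow>\<^sub>M restrict_space borel {0..}"
      unfolding likelihood_space_def by (rule measurable_component_singleton[OF k])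
    from measurable_compose[OF fst_meas this]
    have z: "(\<lambda>p. fst (fst p) k) \<in> ?M \<rightarrow>\<^sub>M restrict_space borel {0..}" .
    then have [measurable]: "(\<lambda>p. fst (fst p) k) \<in> borel_measurable ?M"
      by (simp add: measurable_restrict_space2_iff)
    have [measurable]: "(\<lambda>(\<theta>, x). dens \<pi> \<theta> k x) \<in> borel_measurable (\<Theta> \<Otimes>\<^sub>M \<mu>)"
      using dens k by simp
    show "(\<lambda>p. fst (fst p) k * dens \<pi> (snd (fst p)) k (snd p)) \<in> borel_measurable ?M"
      by measurable
    show "(\<lambda>p. fst (fst p) k * dens \<pi> (snd (fst p)) k (snd p)) \<in> space ?M \<rightarrow> {0..}"
    proof
      fix p assume p: "p \<in> space ?M"
      then have "0 \<le> fst (fst p) k"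
        using z by (auto simp: measurable_restrict_space2_iff)
      moreover have "0 \<le> dens \<pi> (snd (fst p)) k (snd p)"
        using p k by (intro nonneg) (auto simp: state_space_def space_pair_measure)
      ultimately show "fst (fst p) k * dens \<pi> (snd (fst p)) k (snd p) \<in> {0..}"
        by simp
    qed
  qed
  have "(\<lambda>p. (\<lambda>k\<in>{..?K}. fst (fst p) k * dens \<pi> (snd (fst p)) k (snd p))) \<in> ?M \<rightarrow>\<^sub>M likelihood_space ?K"
    unfolding likelihood_space_def by (rule measurable_restrict) (rule comp)
  moreover have "(\<lambda>p. upd \<pi> (snd (fst p)) (snd p)) \<in> ?M \<rightarrow>\<^sub>M \<Theta>"
    by measurable
  ultimately have "(\<lambda>p. (\<lambda>k\<in>{..?K}. fst (fst p) k * dens \<pi> (snd (fst p)) k (snd p),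
      upd \<pi> (snd (fst p)) (snd p))) \<in> ?M \<rightarrow>\<^sub>M likelihood_space ?K \<Otimes>\<^sub>M \<Theta>"
    by (rule measurable_Pair)
  then show ?thesis
    by (simp add: next_state_def split_beta' state_space_def)
qed

lemma state_in_space: "\<omega> \<in> space (paths \<mu>) \<Longrightarrow> state \<pi> \<omega> n \<in> space (state_space \<Theta> \<pi>)"
  unfolding state_def by (rule statistic_in_space[OF measurable_next_state init_state_in_space])

lemma stop_in_unit_interval:
  "s \<in> space (state_space \<Theta> \<pi>) \<Longrightarrow> 0 \<le> stop \<pi> s \<and> stop \<pi> s \<le> 1"
  using policy by (auto simp: testing_policy_def)

lemma decide_in_unit_interval:
  "s \<in> space (state_space \<Theta> \<pi>) \<Longrightarrow> k \<le> last_hyp \<pi> \<Longrightarrow>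
    0 \<le> decide \<pi> k (fst s) \<and> decide \<pi> k (fst s) \<le> 1"
  using policy by (auto simp: testing_policy_def state_space_def space_pair_measure)

lemma measurable_stop: "stop \<pi> \<in> borel_measurable (state_space \<Theta> \<pi>)"
  using policy by (simp add: testing_policy_def)

lemma measurable_continue_prob: "continue_prob \<pi> \<in> borel_measurable (state_space \<Theta> \<pi>)"
  using measurable_stop unfolding continue_prob_def[abs_def] by measurable

lemma measurable_decide:
  assumes "k \<le> last_hyp \<pi>"
  shows "(\<lambda>s. decide \<pi> k (fst s)) \<in> borel_measurable (state_space \<Theta> \<pi>)"
proof -
  have "decide \<pi> k \<in> borel_measurable (likelihood_space (last_hyp \<pi>))"
    using policy assms by (simp add: testing_policy_def)
  then show ?thesis
    unfolding state_space_def by (rule measurable_compose[OF measurable_fst])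
qed

lemma survival_state:
  assumes "\<omega> \<in> space (paths \<mu>)"
  shows "survival (continue_prob \<pi>) (state \<pi> \<omega>) n = ennreal (\<Prod>i<n. 1 - stop \<pi> (state \<pi> \<omega> i))"
  unfolding survival_def continue_prob_def
  using stop_in_unit_interval[OF state_in_space[OF assms]] by (simp add: prod_ennreal)

lemma stop_prob_nonneg: "\<omega> \<in> space (paths \<mu>) \<Longrightarrow> 0 \<le> stop_prob \<pi> \<omega> n"
  unfolding stop_prob_def using stop_in_unit_interval[OF state_in_space]
  by (intro mult_nonneg_nonneg prod_nonneg) auto

text \<open>
  The mass at \<open>\<infinity>\<close> completes the total mass to 1. Hence the tail probabilities are complements of
  the telescoping finite sums of \<open>stop_prob\<close>, whatever the probability of never stopping is.
\<close>

lemma emeasure_stopping_law: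
  assumes \<omega>: "\<omega> \<in> space (paths \<mu>)"
  shows "emeasure (stopping_law \<pi> \<omega>) UNIV = 1"
    and "emeasure (stopping_law \<pi> \<omega>) {enat j<..} = survival (continue_prob \<pi>) (state \<pi> \<omega>) (Suc j)"
proof -
  let ?p = "stop_prob \<pi> \<omega>"
  let ?g = "\<lambda>t. case t of enat n \<Rightarrow> ennreal (?p n) | \<infinity> \<Rightarrow> 1 - (\<Sum>n. ennreal (?p n))"
  let ?S = "\<lambda>m. \<Prod>i<m. 1 - stop \<pi> (state \<pi> \<omega> i)"
  have S: "0 \<le> ?S m" "?S m \<le> 1" for m
    using stop_in_unit_interval[OF state_in_space[OF \<omega>]]
    by (auto intro!: prod_nonneg prod_le_1)
  have partial: "(\<Sum>n<m. ennreal (?p n)) = ennreal (1 - ?S m)" for m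
    by (subst sum_ennreal) (simp_all add: stop_prob_nonneg[OF \<omega>] sum_stop_prob)
  have "(\<Sum>n. ennreal (?p n)) \<le> 1"
    by (rule suminf_le_const) (auto simp: partial S intro: order_trans[OF _ ennreal_1[THEN eq_refl]])
  then show total: "emeasure (stopping_law \<pi> \<omega>) UNIV = 1"
    unfolding stopping_law_def
    by (simp add: emeasure_density nn_integral_count_space_enat add_diff_inverse_ennreal
        diff_add_cancel_ennreal add.commute)
  have "emeasure (stopping_law \<pi> \<omega>) {..enat j} = (\<Sum>n. ?g (enat n) * indicator {..enat j} (enat n))"
    unfolding stopping_law_def by (simp add: emeasure_density nn_integral_count_space_enat)
  also have "\<dots> = (\<Sum>n<Suc j. ennreal (?p n))"
    by (subst suminf_finite[of "{..<Suc j}"]) (auto simp: less_Suc_eq_le)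
  also have "\<dots> = ennreal (1 - ?S (Suc j))"
    by (rule partial)
  finally have le: "emeasure (stopping_law \<pi> \<omega>) {..enat j} = ennreal (1 - ?S (Suc j))" .
  have "emeasure (stopping_law \<pi> \<omega>) {enat j<..} = emeasure (stopping_law \<pi> \<omega>) (UNIV - {..enat j})"
    by (rule arg_cong[where f="emeasure (stopping_law \<pi> \<omega>)"]) auto
  also have "\<dots> = 1 - ennreal (1 - ?S (Suc j))"
    unfolding le[symmetric] total[symmetric]
    by (rule emeasure_Diff) (auto simp: stopping_law_def le[unfolded stopping_law_def])
  also have "\<dots> = ennreal (?S (Suc j))"
    using S[of "Suc j"] by (simp add: ennreal_minus del: ennreal_1 prod.lessThan_Suc flip: ennreal_1)
  finally show "emeasure (stopping_law \<pi> \<omega>) {enat j<..} = survival (continue_prob \<pi>) (state \<pi> \<omega>) (Suc j)"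
    by (simp add: survival_state[OF \<omega>])
qed

text \<open>
  The run length is the sum of the tail probabilities, and the probability to run beyond time \<open>j\<close>
  is the product of the continuation probabilities up to and including time \<open>j\<close>. So each state
  costs its continuation probability.
\<close>

lemma expected_run_length_eq_total_cost:
  assumes "sets P = sets (paths \<mu>)"
  shows "expected_run_length \<pi> P =
    total_cost (continue_prob \<pi>) (continue_prob \<pi>) (init_state \<pi>) (next_state \<pi>) P"
  unfolding expected_run_length_def total_cost_def
proof (rule nn_integral_cong)
  fix \<omega> assume "\<omega> \<in> space P"
  then have \<omega>: "\<omega> \<in> space (paths \<mu>)"
    using sets_eq_imp_space_eq[OF assms] by simp
  have "(\<integral>\<^sup>+t. ennreal_of_enat t \<partial>stopping_law \<pi> \<omega>) =
      (\<Sum>j. \<integral>\<^sup>+t. indicator {enat j<..} t \<partial>stopping_law \<pi> \<omega>)"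
    unfolding ennreal_of_enat_eq_suminf by (rule nn_integral_suminf) (simp add: stopping_law_def)
  also have "\<dots> = (\<Sum>j. emeasure (stopping_law \<pi> \<omega>) {enat j<..})"
    by (simp add: stopping_law_def)
  also have "\<dots> = (\<Sum>j. survival (continue_prob \<pi>) (state \<pi> \<omega>) (Suc j))"
    by (simp only: emeasure_stopping_law[OF \<omega>])
  finally show "(\<integral>\<^sup>+t. ennreal_of_enat t \<partial>stopping_law \<pi> \<omega>) =
      (\<Sum>n. survival (continue_prob \<pi>) (statistic (init_state \<pi>) (next_state \<pi>) \<omega>) n *
        continue_prob \<pi> (statistic (init_state \<pi>) (next_state \<pi>) \<omega> n))"
    by (simp add: survival_def state_def)
qed

text \<open>
  A path on which the test never stops contributes nothing, so only the finite stopping times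
  remain; at each of them the cost is the probability to stop there and decide wrongly.
\<close>

lemma error_prob_eq_total_cost:
  assumes "sets P = sets (paths \<mu>)" and k: "k \<le> last_hyp \<pi>"
  shows "error_prob \<pi> k P = total_cost (\<lambda>s. ennreal (stop \<pi> s * (1 - decide \<pi> k (fst s))))
    (continue_prob \<pi>) (init_state \<pi>) (next_state \<pi>) P"
  unfolding error_prob_def total_cost_def
proof (rule nn_integral_cong)
  fix \<omega> assume "\<omega> \<in> space P"
  then have \<omega>: "\<omega> \<in> space (paths \<mu>)"
    using sets_eq_imp_space_eq[OF assms(1)] by simp
  have "ennreal (stop_prob \<pi> \<omega> n) * ennreal (1 - decide \<pi> k (fst (state \<pi> \<omega> n))) =
      survival (continue_prob \<pi>) (state \<pi> \<omega>) n *
      ennreal (stop \<pi> (state \<pi> \<omega> n) * (1 - decide \<pi> k (fst (state \<pi> \<omega> n))))" for n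
  proof -
    note range = stop_in_unit_interval[OF state_in_space[OF \<omega>]]
      decide_in_unit_interval[OF state_in_space[OF \<omega>] k]
    have "0 \<le> (\<Prod>i<n. 1 - stop \<pi> (state \<pi> \<omega> i))"
      using range by (auto intro!: prod_nonneg)
    then show ?thesis
      using range[of n]
      by (simp add: survival_state[OF \<omega>] stop_prob_def ennreal_mult'[symmetric] mult_ac)
  qed
  then show "(\<integral>\<^sup>+t. (case t of enat n \<Rightarrow> ennreal (1 - decide \<pi> k (fst (state \<pi> \<omega> n))) | \<infinity> \<Rightarrow> 0)
        \<partial>stopping_law \<pi> \<omega>) =
      (\<Sum>n. survival (continue_prob \<pi>) (statistic (init_state \<pi>) (next_state \<pi>) \<omega>) n *
        ennreal (stop \<pi> (statistic (init_state \<pi>) (next_state \<pi>) \<omega> n) *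
          (1 - decide \<pi> k (fst (statistic (init_state \<pi>) (next_state \<pi>) \<omega> n)))))"
    by (simp add: stopping_law_def nn_integral_density nn_integral_count_space_enat flip: state_def)
qed

lemma policy_markov_law_in_uncertainty_set:
  assumes "Q \<in> policy_markov_laws \<mu> \<Theta> \<pi> (maximizers \<pi> C v)"
  shows "Q \<in> uncertainty_set \<mu> (init \<pi>) (upd \<pi>) C"
proof -
  have Q: "Q \<in> markov_laws \<mu>" and con: "markov_constrained \<mu> (state_space \<Theta> \<pi>) (init_state \<pi>)
      (next_state \<pi>) (\<lambda>n \<omega>. maximizers \<pi> C v (state \<pi> \<omega> n)) Q"
    using assms by (auto simp: policy_markov_laws_def)
  have sub: "maximizers \<pi> C v (state \<pi> \<omega> n) \<subseteq> C (statistic (init \<pi>) (upd \<pi>) \<omega> n)" for \<omega> n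
    unfolding snd_state[symmetric] by (auto simp: maximizers_def is_arg_max_def split_beta)
  obtain \<kappa> where rep: "markov_representation \<mu> (state_space \<Theta> \<pi>) (init_state \<pi>) (next_state \<pi>) \<kappa> Q"
    and max: "\<And>n. AE \<omega> in Q. \<kappa> (statistic (init_state \<pi>) (next_state \<pi>) \<omega> n) \<in>
      maximizers \<pi> C v (state \<pi> \<omega> n)"
    using con unfolding markov_constrained_def by blast
  have "AE \<omega> in Q. \<kappa> (statistic (init_state \<pi>) (next_state \<pi>) \<omega> n) \<in>
      C (statistic (init \<pi>) (upd \<pi>) \<omega> n)" for n
    using max[of n] by (rule eventually_mono) (rule subsetD[OF sub])
  with rep have "markov_constrained \<mu> (state_space \<Theta> \<pi>) (init_state \<pi>) (next_state \<pi>)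
      (\<lambda>n \<omega>. C (statistic (init \<pi>) (upd \<pi>) \<omega> n)) Q"
    unfolding markov_constrained_def by blast
  from markov_constrained_history[OF this] Q show ?thesis
    by (simp add: uncertainty_set_def)
qed

text \<open>
  The value at the initial state bounds the cost of every law in the uncertainty set, a maximizing
  law attains it, and a maximizing law belongs to the uncertainty set.
\<close>

lemma least_favorable_if_maximizing:
  assumes uniq: "unique_solution (state_space \<Theta> \<pi>)
      (bellman a (continue_prob \<pi>) (next_state \<pi>) (\<lambda>s. C (snd s))) v"
    and a: "a \<in> borel_measurable (state_space \<Theta> \<pi>)"
    and C: "\<And>\<theta>. \<theta> \<in> space \<Theta> \<Longrightarrow> C \<theta> \<subseteq> distributions_with_density \<mu>"
    and fin: "v (init_state \<pi>) < \<infinity>"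
    and J: "\<And>P. sets P = sets (paths \<mu>) \<Longrightarrow>
      J P = total_cost a (continue_prob \<pi>) (init_state \<pi>) (next_state \<pi>) P"
    and Q: "Q \<in> policy_markov_laws \<mu> \<Theta> \<pi> (maximizers \<pi> C v)"
  shows "least_favorable J (uncertainty_set \<mu> (init \<pi>) (upd \<pi>) C) Q"
proof -
  let ?S = "state_space \<Theta> \<pi>" and ?b = "continue_prob \<pi>" and ?D = "\<lambda>s. C (snd s)"
  let ?T = "bellman a ?b (next_state \<pi>) ?D"
  note step = measurable_next_state and init = init_state_in_space
  have b: "?b \<in> borel_measurable ?S"
    by (rule measurable_continue_prob)
  have b_fin: "?b s < \<infinity>" for s
    by (simp add: continue_prob_def)
  have D: "sets H = sets \<mu>" if "s \<in> space ?S" "H \<in> ?D s" for s H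
  proof -
    have "snd s \<in> space \<Theta>"
      using that(1) by (auto simp: state_space_def space_pair_measure)
    from subsetD[OF C[OF this] that(2)] show ?thesis
      by (rule sets_distributions_with_density)
  qed
  note uniq' = uniq[unfolded unique_solution_def]
  have v: "v \<in> borel_measurable ?S"
    by (rule uniq'[THEN conjunct1])
  have sol: "v s = ?T v s" if "s \<in> space ?S" for s
    using uniq'[THEN conjunct2, THEN conjunct1] that by (rule bspec)
  obtain \<kappa> where rep: "markov_representation \<mu> ?S (init_state \<pi>) (next_state \<pi>) \<kappa> Q"
    and max: "\<And>n. AE \<omega> in Q. \<kappa> (statistic (init_state \<pi>) (next_state \<pi>) \<omega> n) \<in>
      maximizers \<pi> C v (state \<pi> \<omega> n)"
    using Q unfolding policy_markov_laws_def markov_constrained_def by blast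
  have maximizers: "H \<in> maximizers \<pi> C v s \<longleftrightarrow> attains (next_state \<pi>) ?D v s H" for H s
    by (simp add: maximizers_def attains_iff_is_arg_max split_beta)
  have "v (init_state \<pi>) \<le> total_cost a ?b (init_state \<pi>) (next_state \<pi>) Q"
    by (rule solution_le_total_cost[OF rep uniq a b b_fin D max[unfolded maximizers state_def] fin])
  also have "\<dots> = J Q"
    using rep by (simp add: J markov_representation_def)
  finally have lower: "v (init_state \<pi>) \<le> J Q" .
  have upper: "J P \<le> v (init_state \<pi>)" if P: "P \<in> uncertainty_set \<mu> (init \<pi>) (upd \<pi>) C" for P
  proof -
    obtain S' :: "'x list measure" and s0' \<zeta>' \<kappa>' where rep': "markov_representation \<mu> S' s0' \<zeta>' \<kappa>' P"
      and adm: "\<And>n. AE \<omega> in P. \<kappa>' (statistic s0' \<zeta>' \<omega> n) \<in> C (statistic (init \<pi>) (upd \<pi>) \<omega> n)"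
      using P unfolding uncertainty_set_def markov_constrained_def by blast
    have "total_cost a ?b (init_state \<pi>) (next_state \<pi>) P \<le> v (init_state \<pi>)"
      by (rule total_cost_le_solution[OF rep' step init a b v sol
          adm[folded snd_state, unfolded state_def]])
    then show ?thesis
      using rep' by (simp add: J markov_representation_def)
  qed
  have "Q \<in> uncertainty_set \<mu> (init \<pi>) (upd \<pi>) C"
    by (rule policy_markov_law_in_uncertainty_set[OF Q])
  then have "J Q \<le> (SUP P\<in>uncertainty_set \<mu> (init \<pi>) (upd \<pi>) C. J P)"
    by (rule SUP_upper)
  moreover have "(SUP P\<in>uncertainty_set \<mu> (init \<pi>) (upd \<pi>) C. J P) \<le> J Q"
    by (rule SUP_least) (rule order_trans[OF upper lower])
  ultimately show ?thesis
    unfolding least_favorable_def by (rule antisym)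
qed

end

theorem theorem6:
  fixes \<mu> :: "'x measure" and \<Theta> :: "'t measure" and \<pi> :: "('x, 't) policy"
    and C :: "nat \<Rightarrow> 't \<Rightarrow> 'x measure set"
    and \<gamma> :: "(nat \<Rightarrow> real) \<times> 't \<Rightarrow> ennreal"
    and \<alpha> :: "nat \<Rightarrow> (nat \<Rightarrow> real) \<times> 't \<Rightarrow> ennreal"
  assumes "sigma_finite_measure \<mu>"
    and "testing_policy \<mu> \<Theta> \<pi>"
    and "\<And>k \<theta>. k \<le> last_hyp \<pi> \<Longrightarrow> \<theta> \<in> space \<Theta> \<Longrightarrow> C k \<theta> \<subseteq> distributions_with_density \<mu>"
  shows
    "(unique_solution (state_space \<Theta> \<pi>) (run_length_op \<pi> (C 0)) \<gamma> \<and>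
      \<gamma> (init_state \<pi>) < \<infinity> \<and>
      (\<forall>s\<in>space (state_space \<Theta> \<pi>). maximizers \<pi> (C 0) \<gamma> s \<noteq> {}) \<longrightarrow>
      (\<forall>Q\<in>policy_markov_laws \<mu> \<Theta> \<pi> (maximizers \<pi> (C 0) \<gamma>).
         least_favorable (expected_run_length \<pi>)
           (uncertainty_set \<mu> (init \<pi>) (upd \<pi>) (C 0)) Q))
     \<and>
     (\<forall>k\<in>{1..last_hyp \<pi>}.
        unique_solution (state_space \<Theta> \<pi>) (error_op \<pi> k (C k)) (\<alpha> k) \<and>
        (\<forall>s\<in>space (state_space \<Theta> \<pi>). \<alpha> k s < \<infinity>) \<and>
        (\<forall>s\<in>space (state_space \<Theta> \<pi>). maximizers \<pi> (C k) (\<alpha> k) s \<noteq> {}) \<longrightarrow>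
        (\<forall>Q\<in>policy_markov_laws \<mu> \<Theta> \<pi> (maximizers \<pi> (C k) (\<alpha> k)).
           least_favorable (error_prob \<pi> k)
             (uncertainty_set \<mu> (init \<pi>) (upd \<pi>) (C k)) Q))"
proof (intro conjI impI ballI)
  note policy = assms(2) and C = assms(3)
  fix Q
  assume *: "unique_solution (state_space \<Theta> \<pi>) (run_length_op \<pi> (C 0)) \<gamma> \<and>
      \<gamma> (init_state \<pi>) < \<infinity> \<and>
      (\<forall>s\<in>space (state_space \<Theta> \<pi>). maximizers \<pi> (C 0) \<gamma> s \<noteq> {})"
    and Q: "Q \<in> policy_markov_laws \<mu> \<Theta> \<pi> (maximizers \<pi> (C 0) \<gamma>)"
  have "run_length_op \<pi> (C 0) =
      bellman (continue_prob \<pi>) (continue_prob \<pi>) (next_state \<pi>) (\<lambda>s. C 0 (snd s))"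
    by (intro ext) (simp add: run_length_op_def bellman_def continue_prob_def split_beta distrib_left)
  then have uniq: "unique_solution (state_space \<Theta> \<pi>)
      (bellman (continue_prob \<pi>) (continue_prob \<pi>) (next_state \<pi>) (\<lambda>s. C 0 (snd s))) \<gamma>"
    using *[THEN conjunct1] by (rule subst[where P="\<lambda>T. unique_solution _ T _"])
  have fin: "\<gamma> (init_state \<pi>) < \<infinity>"
    by (rule *[THEN conjunct2, THEN conjunct1])
  show "least_favorable (expected_run_length \<pi>) (uncertainty_set \<mu> (init \<pi>) (upd \<pi>) (C 0)) Q"
    by (rule least_favorable_if_maximizing[OF policy uniq measurable_continue_prob[OF policy]
          C[OF le0] fin _ Q])
      (assumption, rule expected_run_length_eq_total_cost[OF policy])
next
  note policy = assms(2) and C = assms(3)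
  fix k Q
  assume k: "k \<in> {1..last_hyp \<pi>}"
    and *: "unique_solution (state_space \<Theta> \<pi>) (error_op \<pi> k (C k)) (\<alpha> k) \<and>
      (\<forall>s\<in>space (state_space \<Theta> \<pi>). \<alpha> k s < \<infinity>) \<and>
      (\<forall>s\<in>space (state_space \<Theta> \<pi>). maximizers \<pi> (C k) (\<alpha> k) s \<noteq> {})"
    and Q: "Q \<in> policy_markov_laws \<mu> \<Theta> \<pi> (maximizers \<pi> (C k) (\<alpha> k))"
  let ?a = "\<lambda>s. ennreal (stop \<pi> s * (1 - decide \<pi> k (fst s)))"
  have k': "k \<le> last_hyp \<pi>"
    using k by simp
  have a: "?a \<in> borel_measurable (state_space \<Theta> \<pi>)"
    using measurable_stop[OF policy] measurable_decide[OF policy k'] by measurable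
  have "error_op \<pi> k (C k) = bellman ?a (continue_prob \<pi>) (next_state \<pi>) (\<lambda>s. C k (snd s))"
    by (intro ext) (simp add: error_op_def bellman_def continue_prob_def split_beta)
  then have uniq: "unique_solution (state_space \<Theta> \<pi>)
      (bellman ?a (continue_prob \<pi>) (next_state \<pi>) (\<lambda>s. C k (snd s))) (\<alpha> k)"
    using *[THEN conjunct1] by (rule subst[where P="\<lambda>T. unique_solution _ T _"])
  have fin: "\<alpha> k (init_state \<pi>) < \<infinity>"
    by (rule bspec[OF *[THEN conjunct2, THEN conjunct1] init_state_in_space[OF policy]])
  show "least_favorable (error_prob \<pi> k) (uncertainty_set \<mu> (init \<pi>) (upd \<pi>) (C k)) Q"
    by (rule least_favorable_if_maximizing[OF policy uniq a C[OF k'] fin _ Q])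
      (assumption, rule error_prob_eq_total_cost[OF policy _ k'])
qed

end
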